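(* Let $S$ be an inverse semigroup with set of idempotents $E$, and let $\ell^1(E)$ act on $\ell^1(S)$ by $\delta_e\cdot\delta_s=\delta_s$ and $\delta_s\cdot\delta_e=\delta_{se}=\delta_s*\delta_e$ ($s\in S,e\in E$). Let $\mathcal T_0=\begin{bmatrix}\ell^1(S)&\ell^1(S)\\&\ell^1(S)\end{bmatrix}$ and $\mathfrak T_0=\left\{\begin{bmatrix}\alpha&\\&\alpha\end{bmatrix}:\alpha\in\ell^1(E)\right\}$. Then $\mathcal T_0$ is module Arens regular (as a Banach $\mathfrak T_0$-module) if and only if $G_S$ is finite.
   Context: A discrete semigroup $S$ is an inverse semigroup if for each $s\in S$ there is a unique $s^*\in S$ with $ss^*s=s$ and $s^*ss^*=s^*$. An idempotent is an $e\in S$ with $e=e^*=e^2$; the set $E$ of idempotents is a commutative subsemigroup, and $\ell^1(E)$ is a subalgebra of the convolution algebra $\ell^1(S)$. $G_S=S/\!\approx$ is the maximal group homomorphic image of $S$, where $s\approx t$ iff $\delta_s-\delta_t$ belongs to the closed linear span in $\ell^1(S)$ of $\{\delta_{set}-\delta_{st}:s,t\in S,e\in E\}$ (the quotient is a discrete group). $\mathcal T_0$ is the algebra of matrices $\begin{bmatrix}a&m\\&b\end{bmatrix}$, $a,m,b\in\ell^1(S)$, with the usual $2\times2$ matrix operations (convolution products) and norm $\|a\|+\|m\|+\|b\|$; $\mathfrak T_0$ acts on it entrywise on both sides. For a Banach algebra $\mathcal A$ that is a Banach $\mathfrak A$-bimodule with $\alpha\cdot(ab)=(\alpha\cdot a)b$,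 $(ab)\cdot\alpha=a(b\cdot\alpha)$, let $J_{\mathcal A}$ be the closed ideal generated by the elements $(a\cdot\alpha)b-a(\alpha\cdot b)$, and let $J_{\mathcal A}^{\perp\perp}\subseteq\mathcal A^{**}$ be the annihilator of $J_{\mathcal A}^{\perp}\subseteq\mathcal A^*$. Let $\Box$ and $\diamond$ be the first and second Arens products on $\mathcal A^{**}$: for $\Gamma_1=w^*\text{-}\lim_i a_i$, $\Gamma_2=w^*\text{-}\lim_j b_j$ with nets in $\mathcal A$, $\Gamma_1\Box\Gamma_2=w^*\text{-}\lim_i\lim_j a_ib_j$ and $\Gamma_1\diamond\Gamma_2=w^*\text{-}\lim_j\lim_i a_ib_j$. $\mathcal A$ is module Arens regular (as a Banach $\mathfrak A$-module) if $\Gamma_1\Box\Gamma_2-\Gamma_1\diamond\Gamma_2\in J_{\mathcal A}^{\perp\perp}$ for all $\Gamma_1,\Gamma_2\in\mathcal A^{**}$. This is applied with $\mathcal A=\mathcal T_0$, $\mathfrak A=\mathfrak T_0$. *)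

theory Defs
  imports "HOL-Analysis.Infinite_Sum" "HOL-Analysis.Operator_Norm"
begin

section \<open>Complex Banach algebras\<close>

class complex_vector = real_vector +
  fixes scaleC :: "complex \<Rightarrow> 'a \<Rightarrow> 'a" (infixr "*\<^sub>C" 75)
  assumes scaleC_add_right: "c *\<^sub>C (x + y) = c *\<^sub>C x + c *\<^sub>C y"
    and scaleC_add_left: "(c + d) *\<^sub>C x = c *\<^sub>C x + d *\<^sub>C x"
    and scaleC_scaleC: "c *\<^sub>C d *\<^sub>C x = (c * d) *\<^sub>C x"
    and scaleC_one: "1 *\<^sub>C x = x"
    and scaleR_scaleC: "r *\<^sub>R x = complex_of_real r *\<^sub>C x"

global_interpretation complex_vector: vector_space "scaleC :: complex \<Rightarrow> 'a \<Rightarrow> 'a::complex_vector"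
  defines csubspace = complex_vector.subspace
    and cspan = complex_vector.span
  by unfold_locales (simp_all add: scaleC_add_right scaleC_add_left scaleC_scaleC scaleC_one)

class complex_normed_vector = complex_vector + real_normed_vector +
  assumes norm_scaleC: "norm (c *\<^sub>C x) = cmod c * norm x"

class complex_normed_algebra = complex_normed_vector + real_normed_algebra +
  assumes mult_scaleC_left: "(c *\<^sub>C x) * y = c *\<^sub>C (x * y)"
    and mult_scaleC_right: "x * (c *\<^sub>C y) = c *\<^sub>C (x * y)"

class complex_banach_algebra = complex_normed_algebra + banach


section \<open>The dual space\<close>

typedef (overloaded) 'a cdual =
  "{f :: 'a::complex_normed_vector \<Rightarrow> complex. bounded_linear f \<and> (\<forall>c x. f (c *\<^sub>C x) = c * f x)}"
  morphisms dual_apply Abs_cdual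
  by (rule exI[of _ "\<lambda>_. 0"]) simp

setup_lifting type_definition_cdual

notation dual_apply ("\<langle>_, _\<rangle>")

lemma bounded_linear_dual_apply: "bounded_linear (dual_apply f)"
  using dual_apply[of f] by auto

lemma dual_apply_scaleC: "\<langle>f, c *\<^sub>C x\<rangle> = c * \<langle>f, x\<rangle>"
  using dual_apply[of f] by auto

lemma dual_apply_add: "\<langle>f, x + y\<rangle> = \<langle>f, x\<rangle> + \<langle>f, y\<rangle>"
  and dual_apply_diff: "\<langle>f, x - y\<rangle> = \<langle>f, x\<rangle> - \<langle>f, y\<rangle>"
  and dual_apply_zero: "\<langle>f, 0\<rangle> = 0"
  using bounded_linear_dual_apply[of f]
  by (simp_all add: bounded_linear.linear linear_add linear_diff linear_0)

lemma cdual_eqI: "(\<And>x. \<langle>f, x\<rangle> = \<langle>g, x\<rangle>) \<Longrightarrow> f = g"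
  by (metis dual_apply_inject ext)

instantiation cdual :: (complex_normed_vector) complex_normed_vector
begin

lift_definition norm_cdual :: "'a cdual \<Rightarrow> real" is onorm .

lift_definition minus_cdual :: "'a cdual \<Rightarrow> 'a cdual \<Rightarrow> 'a cdual" is "\<lambda>f g x. f x - g x"
  by (auto intro: bounded_linear_sub simp: algebra_simps)

lift_definition plus_cdual :: "'a cdual \<Rightarrow> 'a cdual \<Rightarrow> 'a cdual" is "\<lambda>f g x. f x + g x"
  by (auto intro: bounded_linear_add simp: algebra_simps)

lift_definition uminus_cdual :: "'a cdual \<Rightarrow> 'a cdual" is "\<lambda>f x. - f x"
  by (auto intro: bounded_linear_minus)

lift_definition zero_cdual :: "'a cdual" is "\<lambda>_. 0"
  by simp

lift_definition scaleC_cdual :: "complex \<Rightarrow> 'a cdual \<Rightarrow> 'a cdual" is "\<lambda>c f x. c * f x"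
  by (auto intro: bounded_linear_const_mult)

definition scaleR_cdual :: "real \<Rightarrow> 'a cdual \<Rightarrow> 'a cdual"
  where "scaleR_cdual r f = complex_of_real r *\<^sub>C f"

definition sgn_cdual :: "'a cdual \<Rightarrow> 'a cdual"
  where "sgn_cdual f = scaleR (inverse (norm f)) f"

definition dist_cdual :: "'a cdual \<Rightarrow> 'a cdual \<Rightarrow> real"
  where "dist_cdual f g = norm (f - g)"

definition uniformity_cdual :: "('a cdual \<times> 'a cdual) filter"
  where "uniformity_cdual = (INF e\<in>{0 <..}. principal {(f, g). dist f g < e})"

definition open_cdual :: "'a cdual set \<Rightarrow> bool"
  where "open_cdual U = (\<forall>f\<in>U. \<forall>\<^sub>F (f', g) in uniformity. f' = f \<longrightarrow> g \<in> U)"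

instance
proof
  fix f g h :: "'a cdual" and r s :: real and c d :: complex
  show "f + g + h = f + (g + h)" "f + g = g + f" "0 + f = f" "- f + f = 0" "f - g = f + - g"
    by (transfer, simp add: fun_eq_iff)+
  have C: "c *\<^sub>C (f + g) = c *\<^sub>C f + c *\<^sub>C g" "(c + d) *\<^sub>C f = c *\<^sub>C f + d *\<^sub>C f"
    "c *\<^sub>C d *\<^sub>C f = (c * d) *\<^sub>C f" "1 *\<^sub>C f = f" for c d and f g :: "'a cdual"
    by (transfer, simp add: fun_eq_iff algebra_simps)+
  show "c *\<^sub>C (f + g) = c *\<^sub>C f + c *\<^sub>C g" "(c + d) *\<^sub>C f = c *\<^sub>C f + d *\<^sub>C f"
    "c *\<^sub>C d *\<^sub>C f = (c * d) *\<^sub>C f" "1 *\<^sub>C f = f"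
    by - (rule C)+
  show "r *\<^sub>R f = complex_of_real r *\<^sub>C f"
    by (simp add: scaleR_cdual_def)
  show "r *\<^sub>R (f + g) = r *\<^sub>R f + r *\<^sub>R g" "(r + s) *\<^sub>R f = r *\<^sub>R f + s *\<^sub>R f"
    "r *\<^sub>R s *\<^sub>R f = (r * s) *\<^sub>R f" "1 *\<^sub>R f = f"
    by (simp_all add: scaleR_cdual_def C)
  show N: "norm (c *\<^sub>C f) = cmod c * norm f" for c
  proof transfer
    fix f :: "'a \<Rightarrow> complex" and c :: complex
    assume f: "bounded_linear f \<and> (\<forall>c x. f (c *\<^sub>C x) = c * f x)"
    have le: "onorm (\<lambda>x. c * g x) \<le> cmod c * onorm g" if "bounded_linear g" for c and g :: "'a \<Rightarrow> complex"
    proof (rule onorm_bound)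
      show "0 \<le> cmod c * onorm g" using onorm_pos_le[OF that] by simp
      show "cmod (c * g x) \<le> cmod c * onorm g * norm x" for x
        using onorm[OF that, of x] by (simp add: norm_mult mult_left_mono mult.assoc)
    qed
    show "onorm (\<lambda>x. c * f x) = cmod c * onorm f"
    proof (cases "c = 0")
      case False
      have "onorm (\<lambda>x. inverse c * (c * f x)) \<le> cmod (inverse c) * onorm (\<lambda>x. c * f x)"
        using f by (intro le bounded_linear_const_mult) auto
      with False have "onorm f \<le> onorm (\<lambda>x. c * f x) / cmod c"
        by (simp add: mult.assoc[symmetric] norm_inverse divide_inverse mult.commute)
      with False have "cmod c * onorm f \<le> onorm (\<lambda>x. c * f x)"
        by (simp add: pos_le_divide_eq mult.commute)
      with le[of f c] f show ?thesis by simp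
    qed (simp add: onorm_zero)
  qed
  show "norm (r *\<^sub>R f) = \<bar>r\<bar> * norm f"
    by (simp add: scaleR_cdual_def N)
  show "sgn f = inverse (norm f) *\<^sub>R f" "dist f g = norm (f - g)"
    by (simp_all add: sgn_cdual_def dist_cdual_def)
  show "uniformity = (INF e\<in>{0 <..}. principal {(f, g :: 'a cdual). dist f g < e})"
    by (simp add: uniformity_cdual_def)
  show "open U = (\<forall>f\<in>U. \<forall>\<^sub>F (f', g) in uniformity. f' = f \<longrightarrow> g \<in> U)" for U :: "'a cdual set"
    by (simp add: open_cdual_def)
  show "norm f = 0 \<longleftrightarrow> f = 0"
    by transfer (auto simp: onorm_eq_0)
  show "norm (f + g) \<le> norm f + norm g"
    by transfer (auto intro: onorm_triangle)
qed

end

lemma norm_dual_apply: "cmod \<langle>f, x\<rangle> \<le> norm f * norm x"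
  by transfer (auto intro: onorm)

lemma norm_cdual_le: "0 \<le> K \<Longrightarrow> (\<And>x. cmod \<langle>f, x\<rangle> \<le> K * norm x) \<Longrightarrow> norm f \<le> K"
  by transfer (auto intro: onorm_bound)

definition annihilator :: "'a::complex_normed_vector set \<Rightarrow> 'a cdual set"
  where "annihilator M = {f. \<forall>x\<in>M. \<langle>f, x\<rangle> = 0}"

lift_definition bidual_embed :: "'a::complex_normed_vector \<Rightarrow> 'a cdual cdual" is "\<lambda>a f. \<langle>f, a\<rangle>"
proof (intro conjI allI)
  fix a :: 'a
  show "bounded_linear (\<lambda>f. \<langle>f, a\<rangle>)"
    by (rule bounded_linear_intro[where K = "norm a"])
      (simp_all add: norm_dual_apply plus_cdual.rep_eq scaleR_scaleC scaleC_cdual.rep_eq scaleR_conv_of_real)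
  show "\<langle>c *\<^sub>C f, a\<rangle> = c * \<langle>f, a\<rangle>" for c f
    by (simp add: scaleC_cdual.rep_eq)
qed

definition weak_star_lim :: "('i \<Rightarrow> 'a::complex_normed_vector cdual) \<Rightarrow> 'a cdual \<Rightarrow> 'i filter \<Rightarrow> bool"
  where "weak_star_lim X \<Gamma> F \<longleftrightarrow> (\<forall>f. ((\<lambda>i. \<langle>X i, f\<rangle>) \<longlongrightarrow> \<langle>\<Gamma>, f\<rangle>) F)"


section \<open>Arens products\<close>

text \<open>
  A net in \<^typ>\<open>'a\<close> enters these definitions only through its eventuality filter on \<^typ>\<open>'a\<close>,
  so nets \<open>a\<^sub>i \<rightarrow> \<Gamma>\<^sub>1\<close> and \<open>b\<^sub>j \<rightarrow> \<Gamma>\<^sub>2\<close> are represented by proper filters \<open>F\<close> and \<open>G\<close> on \<^typ>\<open>'a\<close>.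
  In each product \<open>\<Phi>\<close> is the inner iterated weak-star limit.  The lemmas \<open>is_arens1_iff\<close> and
  \<open>is_arens2_iff\<close> below show that such filters always exist, that the iterated limits exist, and
  that they do not depend on the choice of \<open>F\<close> and \<open>G\<close>, so both descriptions are proper.
\<close>

definition is_arens1 ::
  "'a::complex_normed_algebra cdual cdual \<Rightarrow> 'a cdual cdual \<Rightarrow> 'a cdual cdual \<Rightarrow> bool"
  where "is_arens1 \<Gamma>\<^sub>1 \<Gamma>\<^sub>2 P \<longleftrightarrow>
    (\<forall>F G. F \<noteq> bot \<longrightarrow> G \<noteq> bot \<longrightarrow>
      weak_star_lim bidual_embed \<Gamma>\<^sub>1 F \<longrightarrow> weak_star_lim bidual_embed \<Gamma>\<^sub>2 G \<longrightarrow>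
      (\<exists>\<Phi>. (\<forall>a. weak_star_lim (\<lambda>b. bidual_embed (a * b)) (\<Phi> a) G) \<and> weak_star_lim \<Phi> P F))"

definition is_arens2 ::
  "'a::complex_normed_algebra cdual cdual \<Rightarrow> 'a cdual cdual \<Rightarrow> 'a cdual cdual \<Rightarrow> bool"
  where "is_arens2 \<Gamma>\<^sub>1 \<Gamma>\<^sub>2 P \<longleftrightarrow>
    (\<forall>F G. F \<noteq> bot \<longrightarrow> G \<noteq> bot \<longrightarrow>
      weak_star_lim bidual_embed \<Gamma>\<^sub>1 F \<longrightarrow> weak_star_lim bidual_embed \<Gamma>\<^sub>2 G \<longrightarrow>
      (\<exists>\<Phi>. (\<forall>b. weak_star_lim (\<lambda>a. bidual_embed (a * b)) (\<Phi> b) F) \<and> weak_star_lim \<Phi> P G))"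

definition arens1 ::
  "'a::complex_normed_algebra cdual cdual \<Rightarrow> 'a cdual cdual \<Rightarrow> 'a cdual cdual" (infixl "\<box>" 70)
  where "\<Gamma>\<^sub>1 \<box> \<Gamma>\<^sub>2 = (THE P. is_arens1 \<Gamma>\<^sub>1 \<Gamma>\<^sub>2 P)"

definition arens2 ::
  "'a::complex_normed_algebra cdual cdual \<Rightarrow> 'a cdual cdual \<Rightarrow> 'a cdual cdual" (infixl "\<diamond>" 70)
  where "\<Gamma>\<^sub>1 \<diamond> \<Gamma>\<^sub>2 = (THE P. is_arens2 \<Gamma>\<^sub>1 \<Gamma>\<^sub>2 P)"

lemma cspan_if_common_kernel:
  fixes K :: "'a::complex_normed_vector cdual set"
  assumes "finite K" and "\<And>x. (\<forall>f\<in>K. \<langle>f, x\<rangle> = 0) \<Longrightarrow> \<langle>g, x\<rangle> = 0"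
  shows "g \<in> cspan K"
  using assms
proof (induction K arbitrary: g)
  case empty
  then have "g = 0" by (intro cdual_eqI) (simp add: zero_cdual.rep_eq)
  then show ?case by (simp add: complex_vector.span_zero)
next
  case (insert h K)
  show ?case
  proof (cases "\<forall>x. (\<forall>f\<in>K. \<langle>f, x\<rangle> = 0) \<longrightarrow> \<langle>g, x\<rangle> = 0")
    case True
    then have "g \<in> cspan K" using insert.IH by blast
    then show ?thesis
      by (meson complex_vector.span_mono subset_insertI subsetD)
  next
    case False
    then obtain x where x: "\<And>f. f \<in> K \<Longrightarrow> \<langle>f, x\<rangle> = 0" "\<langle>g, x\<rangle> \<noteq> 0" by blast
    then have hx: "\<langle>h, x\<rangle> \<noteq> 0" using insert.prems by auto
    define c where "c = \<langle>g, x\<rangle> / \<langle>h, x\<rangle>"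
    have "g - c *\<^sub>C h \<in> cspan K"
    proof (rule insert.IH)
      fix y assume y: "\<forall>f\<in>K. \<langle>f, y\<rangle> = 0"
      define z where "z = y - (\<langle>h, y\<rangle> / \<langle>h, x\<rangle>) *\<^sub>C x"
      have "\<langle>g, z\<rangle> = 0"
        using x y hx by (intro insert.prems) (auto simp: z_def dual_apply_diff dual_apply_scaleC)
      then show "\<langle>g - c *\<^sub>C h, y\<rangle> = 0"
        by (simp add: z_def c_def dual_apply_diff dual_apply_scaleC minus_cdual.rep_eq
            scaleC_cdual.rep_eq)
    qed
    then have "g - c *\<^sub>C h \<in> cspan (insert h K)"
      by (meson complex_vector.span_mono subset_insertI subsetD)
    moreover have "c *\<^sub>C h \<in> cspan (insert h K)"
      by (simp add: complex_vector.span_base complex_vector.span_scale)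
    ultimately have "g - c *\<^sub>C h + c *\<^sub>C h \<in> cspan (insert h K)"
      by (rule complex_vector.span_add)
    then show ?thesis by simp
  qed
qed

lemma bidual_eq_embed_on_finite:
  fixes \<Gamma> :: "'a::complex_normed_vector cdual cdual"
  assumes "finite K"
  shows "\<exists>a. \<forall>f\<in>K. \<langle>f, a\<rangle> = \<langle>\<Gamma>, f\<rangle>"
  using assms
proof (induction K)
  case (insert h K)
  then obtain a where a: "\<And>f. f \<in> K \<Longrightarrow> \<langle>f, a\<rangle> = \<langle>\<Gamma>, f\<rangle>" by blast
  show ?case
  proof (cases "\<forall>x. (\<forall>f\<in>K. \<langle>f, x\<rangle> = 0) \<longrightarrow> \<langle>h, x\<rangle> = 0")
    case True
    then have "h \<in> cspan K" using cspan_if_common_kernel insert.hyps by blast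
    moreover have "complex_vector.subspace {f. \<langle>f, a\<rangle> = \<langle>\<Gamma>, f\<rangle>}"
      by (simp add: complex_vector.subspace_def dual_apply_add dual_apply_zero dual_apply_scaleC
          plus_cdual.rep_eq zero_cdual.rep_eq scaleC_cdual.rep_eq)
    moreover have "K \<subseteq> {f. \<langle>f, a\<rangle> = \<langle>\<Gamma>, f\<rangle>}" using a by blast
    ultimately have "\<langle>h, a\<rangle> = \<langle>\<Gamma>, h\<rangle>"
      using complex_vector.span_minimal by blast
    with a show ?thesis by blast
  next
    case False
    then obtain x where x: "\<And>f. f \<in> K \<Longrightarrow> \<langle>f, x\<rangle> = 0" "\<langle>h, x\<rangle> \<noteq> 0" by blast
    define a' where "a' = a + ((\<langle>\<Gamma>, h\<rangle> - \<langle>h, a\<rangle>) / \<langle>h, x\<rangle>) *\<^sub>C x"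
    have "\<forall>f\<in>insert h K. \<langle>f, a'\<rangle> = \<langle>\<Gamma>, f\<rangle>"
      using a x by (auto simp: a'_def dual_apply_add dual_apply_scaleC)
    then show ?thesis ..
  qed
qed simp

lemma weak_star_dense:
  fixes \<Gamma> :: "'a::complex_normed_vector cdual cdual"
  obtains F where "F \<noteq> bot" "weak_star_lim bidual_embed \<Gamma> F"
proof
  define U where "U K = {a. \<forall>f\<in>K. \<langle>f, a\<rangle> = \<langle>\<Gamma>, f\<rangle>}" for K
  define F where "F = (INF K\<in>{K. finite K}. principal (U K))"
  have ev: "eventually P F \<longleftrightarrow> (\<exists>K\<in>{K. finite K}. eventually P (principal (U K)))" for P
    unfolding F_def
  proof (rule eventually_INF_base)
    fix K L :: "'a cdual set" assume "K \<in> {K. finite K}" "L \<in> {K. finite K}"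
    then show "\<exists>M\<in>{K. finite K}. principal (U M) \<le> inf (principal (U K)) (principal (U L))"
      by (intro bexI[of _ "K \<union> L"]) (auto simp: U_def)
  qed auto
  show "F \<noteq> bot"
    using bidual_eq_embed_on_finite[of _ \<Gamma>]
    by (auto simp: trivial_limit_def ev eventually_principal U_def)
  show "weak_star_lim bidual_embed \<Gamma> F"
    unfolding weak_star_lim_def
  proof
    fix f
    have "\<forall>\<^sub>F a in F. \<langle>bidual_embed a, f\<rangle> = \<langle>\<Gamma>, f\<rangle>"
      unfolding ev
      by (rule bexI[of _ "{f}"]) (auto simp: eventually_principal U_def bidual_embed.rep_eq)
    then show "((\<lambda>a. \<langle>bidual_embed a, f\<rangle>) \<longlongrightarrow> \<langle>\<Gamma>, f\<rangle>) F"
      by (rule tendsto_eventually)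
  qed
qed

lemma weak_star_lim_unique: "F \<noteq> bot \<Longrightarrow> weak_star_lim X P F \<Longrightarrow> weak_star_lim X Q F \<Longrightarrow> P = Q"
  unfolding weak_star_lim_def by (blast intro: cdual_eqI tendsto_unique)

text \<open>\<open>f \<cdot> a\<close> and \<open>a \<cdot> f\<close>, i.e. the functionals \<open>b \<mapsto> f (a b)\<close> and \<open>b \<mapsto> f (b a)\<close>.\<close>

lift_definition dual_right :: "'a::complex_normed_algebra cdual \<Rightarrow> 'a \<Rightarrow> 'a cdual" is "\<lambda>f a b. f (a * b)"
  by (auto simp: mult_scaleC_right intro: bounded_linear_compose[OF _ bounded_linear_mult_right])

lift_definition dual_left :: "'a::complex_normed_algebra \<Rightarrow> 'a cdual \<Rightarrow> 'a cdual" is "\<lambda>a f b. f (b * a)"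
  by (auto simp: mult_scaleC_left intro: bounded_linear_compose[OF _ bounded_linear_mult_left])

lemma norm_dual_right: "norm (dual_right f a) \<le> norm f * norm a"
proof (rule norm_cdual_le)
  fix b
  have "cmod \<langle>dual_right f a, b\<rangle> \<le> norm f * norm (a * b)"
    by (simp add: dual_right.rep_eq norm_dual_apply)
  also have "\<dots> \<le> norm f * (norm a * norm b)" by (intro mult_left_mono norm_mult_ineq) simp
  finally show "cmod \<langle>dual_right f a, b\<rangle> \<le> norm f * norm a * norm b" by (simp add: mult.assoc)
qed simp

lemma norm_dual_left: "norm (dual_left a f) \<le> norm f * norm a"
proof (rule norm_cdual_le)
  fix b
  have "cmod \<langle>dual_left a f, b\<rangle> \<le> norm f * norm (b * a)"
    by (simp add: dual_left.rep_eq norm_dual_apply)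
  also have "\<dots> \<le> norm f * (norm b * norm a)" by (intro mult_left_mono norm_mult_ineq) simp
  finally show "cmod \<langle>dual_left a f, b\<rangle> \<le> norm f * norm a * norm b" by (simp add: mult_ac)
qed simp

lemma dual_right_linear:
  "dual_right (f + g) a = dual_right f a + dual_right g a"
  "dual_right f (a + b) = dual_right f a + dual_right f b"
  "dual_right (c *\<^sub>C f) a = c *\<^sub>C dual_right f a"
  "dual_right f (c *\<^sub>C a) = c *\<^sub>C dual_right f a"
  by (rule cdual_eqI; simp add: dual_right.rep_eq plus_cdual.rep_eq scaleC_cdual.rep_eq
      distrib_right mult_scaleC_left dual_apply_add dual_apply_scaleC)+

lemma dual_left_linear:
  "dual_left a (f + g) = dual_left a f + dual_left a g"
  "dual_left (a + b) f = dual_left a f + dual_left b f"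
  "dual_left a (c *\<^sub>C f) = c *\<^sub>C dual_left a f"
  "dual_left (c *\<^sub>C a) f = c *\<^sub>C dual_left a f"
  by (rule cdual_eqI; simp add: dual_left.rep_eq plus_cdual.rep_eq scaleC_cdual.rep_eq
      distrib_left mult_scaleC_right dual_apply_add dual_apply_scaleC)+

lemma bounded_bilinear_pairing:
  fixes u :: "'a::complex_normed_vector \<Rightarrow> 'b::complex_normed_vector cdual"
  assumes "\<And>a b. u (a + b) = u a + u b" "\<And>c a. u (c *\<^sub>C a) = c *\<^sub>C u a" "\<And>a. norm (u a) \<le> K * norm a"
  shows "bounded_linear (\<lambda>a. \<langle>\<Gamma>, u a\<rangle>)" "\<langle>\<Gamma>, u (c *\<^sub>C a)\<rangle> = c * \<langle>\<Gamma>, u a\<rangle>"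
proof -
  show "bounded_linear (\<lambda>a. \<langle>\<Gamma>, u a\<rangle>)"
  proof (rule bounded_linear_intro[where K = "norm \<Gamma> * K"])
    show "norm \<langle>\<Gamma>, u a\<rangle> \<le> norm a * (norm \<Gamma> * K)" for a
    proof -
      have "norm \<langle>\<Gamma>, u a\<rangle> \<le> norm \<Gamma> * norm (u a)" by (rule norm_dual_apply)
      also have "\<dots> \<le> norm \<Gamma> * (K * norm a)" using assms(3) by (intro mult_left_mono) auto
      finally show ?thesis by (simp add: mult_ac)
    qed
  qed (simp_all add: assms scaleR_scaleC dual_apply_add dual_apply_scaleC scaleR_conv_of_real)
  show "\<langle>\<Gamma>, u (c *\<^sub>C a)\<rangle> = c * \<langle>\<Gamma>, u a\<rangle>" by (simp add: assms dual_apply_scaleC)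
qed

lift_definition bidual_left :: "'a::complex_normed_algebra cdual cdual \<Rightarrow> 'a cdual \<Rightarrow> 'a cdual"
  is "\<lambda>\<Gamma> f a. \<langle>\<Gamma>, dual_right f a\<rangle>"
  using bounded_bilinear_pairing[OF dual_right_linear(2,4) norm_dual_right] by blast

lift_definition bidual_right :: "'a::complex_normed_algebra cdual \<Rightarrow> 'a cdual cdual \<Rightarrow> 'a cdual"
  is "\<lambda>f \<Gamma> a. \<langle>\<Gamma>, dual_left a f\<rangle>"
  using bounded_bilinear_pairing[OF dual_left_linear(2,4) norm_dual_left] by blast

lemma norm_bidual_left: "norm (bidual_left \<Gamma> f) \<le> norm \<Gamma> * norm f"
proof (rule norm_cdual_le)
  fix a
  have "cmod \<langle>bidual_left \<Gamma> f, a\<rangle> \<le> norm \<Gamma> * norm (dual_right f a)"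
    by (simp add: bidual_left.rep_eq norm_dual_apply)
  also have "\<dots> \<le> norm \<Gamma> * (norm f * norm a)" by (intro mult_left_mono norm_dual_right) simp
  finally show "cmod \<langle>bidual_left \<Gamma> f, a\<rangle> \<le> norm \<Gamma> * norm f * norm a" by (simp add: mult.assoc)
qed simp

lemma norm_bidual_right: "norm (bidual_right f \<Gamma>) \<le> norm \<Gamma> * norm f"
proof (rule norm_cdual_le)
  fix a
  have "cmod \<langle>bidual_right f \<Gamma>, a\<rangle> \<le> norm \<Gamma> * norm (dual_left a f)"
    by (simp add: bidual_right.rep_eq norm_dual_apply)
  also have "\<dots> \<le> norm \<Gamma> * (norm f * norm a)" by (intro mult_left_mono norm_dual_left) simp
  finally show "cmod \<langle>bidual_right f \<Gamma>, a\<rangle> \<le> norm \<Gamma> * norm f * norm a" by (simp add: mult.assoc)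
qed simp

lemma bidual_left_linear:
  "bidual_left \<Gamma> (f + g) = bidual_left \<Gamma> f + bidual_left \<Gamma> g"
  "bidual_left \<Gamma> (c *\<^sub>C f) = c *\<^sub>C bidual_left \<Gamma> f"
  by (rule cdual_eqI; simp add: bidual_left.rep_eq plus_cdual.rep_eq scaleC_cdual.rep_eq
      dual_right_linear dual_apply_add dual_apply_scaleC)+

lemma bidual_right_linear:
  "bidual_right (f + g) \<Gamma> = bidual_right f \<Gamma> + bidual_right g \<Gamma>"
  "bidual_right (c *\<^sub>C f) \<Gamma> = c *\<^sub>C bidual_right f \<Gamma>"
  by (rule cdual_eqI; simp add: bidual_right.rep_eq plus_cdual.rep_eq scaleC_cdual.rep_eq
      dual_left_linear dual_apply_add dual_apply_scaleC)+

lift_definition arens1_dual :: "'a::complex_normed_algebra cdual cdual \<Rightarrow> 'a cdual cdual \<Rightarrow> 'a cdual cdual"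
  is "\<lambda>\<Gamma>\<^sub>1 \<Gamma>\<^sub>2 f. \<langle>\<Gamma>\<^sub>1, bidual_left \<Gamma>\<^sub>2 f\<rangle>"
  using bounded_bilinear_pairing[OF bidual_left_linear norm_bidual_left] by blast

lift_definition arens2_dual :: "'a::complex_normed_algebra cdual cdual \<Rightarrow> 'a cdual cdual \<Rightarrow> 'a cdual cdual"
  is "\<lambda>\<Gamma>\<^sub>1 \<Gamma>\<^sub>2 f. \<langle>\<Gamma>\<^sub>2, bidual_right f \<Gamma>\<^sub>1\<rangle>"
  using bounded_bilinear_pairing[OF bidual_right_linear norm_bidual_right] by blast

lemma is_arens1_iff: "is_arens1 \<Gamma>\<^sub>1 \<Gamma>\<^sub>2 P \<longleftrightarrow> P = arens1_dual \<Gamma>\<^sub>1 \<Gamma>\<^sub>2"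
proof -
  have lims: "(\<forall>a. weak_star_lim (\<lambda>b. bidual_embed (a * b)) (arens1_dual (bidual_embed a) \<Gamma>\<^sub>2) G) \<and>
      weak_star_lim (\<lambda>a. arens1_dual (bidual_embed a) \<Gamma>\<^sub>2) (arens1_dual \<Gamma>\<^sub>1 \<Gamma>\<^sub>2) F"
    if F: "weak_star_lim bidual_embed \<Gamma>\<^sub>1 F" and G: "weak_star_lim bidual_embed \<Gamma>\<^sub>2 G" for F G
  proof (intro conjI allI)
    fix a
    have "((\<lambda>b. \<langle>bidual_embed b, dual_right f a\<rangle>) \<longlongrightarrow> \<langle>\<Gamma>\<^sub>2, dual_right f a\<rangle>) G" for f
      using G by (simp add: weak_star_lim_def)
    then show "weak_star_lim (\<lambda>b. bidual_embed (a * b)) (arens1_dual (bidual_embed a) \<Gamma>\<^sub>2) G"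
      by (simp add: weak_star_lim_def bidual_embed.rep_eq arens1_dual.rep_eq bidual_left.rep_eq
          dual_right.rep_eq)
  next
    have "((\<lambda>a. \<langle>bidual_embed a, bidual_left \<Gamma>\<^sub>2 f\<rangle>) \<longlongrightarrow> \<langle>\<Gamma>\<^sub>1, bidual_left \<Gamma>\<^sub>2 f\<rangle>) F" for f
      using F by (simp add: weak_star_lim_def)
    then show "weak_star_lim (\<lambda>a. arens1_dual (bidual_embed a) \<Gamma>\<^sub>2) (arens1_dual \<Gamma>\<^sub>1 \<Gamma>\<^sub>2) F"
      by (simp add: weak_star_lim_def arens1_dual.rep_eq)
  qed
  obtain F where F: "F \<noteq> bot" "weak_star_lim bidual_embed \<Gamma>\<^sub>1 F" by (rule weak_star_dense)
  obtain G where G: "G \<noteq> bot" "weak_star_lim bidual_embed \<Gamma>\<^sub>2 G" by (rule weak_star_dense)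
  show ?thesis
  proof
    assume "is_arens1 \<Gamma>\<^sub>1 \<Gamma>\<^sub>2 P"
    then obtain \<Phi> where \<Phi>: "\<And>a. weak_star_lim (\<lambda>b. bidual_embed (a * b)) (\<Phi> a) G" "weak_star_lim \<Phi> P F"
      using F G unfolding is_arens1_def by blast
    have "\<Phi> = (\<lambda>a. arens1_dual (bidual_embed a) \<Gamma>\<^sub>2)"
      using weak_star_lim_unique[OF G(1) \<Phi>(1)] lims[OF F(2) G(2)] by blast
    with \<Phi>(2) show "P = arens1_dual \<Gamma>\<^sub>1 \<Gamma>\<^sub>2"
      using weak_star_lim_unique[OF F(1)] lims[OF F(2) G(2)] by blast
  next
    assume "P = arens1_dual \<Gamma>\<^sub>1 \<Gamma>\<^sub>2"
    then show "is_arens1 \<Gamma>\<^sub>1 \<Gamma>\<^sub>2 P"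
      unfolding is_arens1_def by (intro allI impI exI[of _ "\<lambda>a. arens1_dual (bidual_embed a) \<Gamma>\<^sub>2"]) (simp only: lims simp_thms)
  qed
qed

lemma is_arens2_iff: "is_arens2 \<Gamma>\<^sub>1 \<Gamma>\<^sub>2 P \<longleftrightarrow> P = arens2_dual \<Gamma>\<^sub>1 \<Gamma>\<^sub>2"
proof -
  have lims: "(\<forall>b. weak_star_lim (\<lambda>a. bidual_embed (a * b)) (arens2_dual \<Gamma>\<^sub>1 (bidual_embed b)) F) \<and>
      weak_star_lim (\<lambda>b. arens2_dual \<Gamma>\<^sub>1 (bidual_embed b)) (arens2_dual \<Gamma>\<^sub>1 \<Gamma>\<^sub>2) G"
    if F: "weak_star_lim bidual_embed \<Gamma>\<^sub>1 F" and G: "weak_star_lim bidual_embed \<Gamma>\<^sub>2 G" for F G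
  proof (intro conjI allI)
    fix b
    have "((\<lambda>a. \<langle>bidual_embed a, dual_left b f\<rangle>) \<longlongrightarrow> \<langle>\<Gamma>\<^sub>1, dual_left b f\<rangle>) F" for f
      using F by (simp add: weak_star_lim_def)
    then show "weak_star_lim (\<lambda>a. bidual_embed (a * b)) (arens2_dual \<Gamma>\<^sub>1 (bidual_embed b)) F"
      by (simp add: weak_star_lim_def bidual_embed.rep_eq arens2_dual.rep_eq bidual_right.rep_eq
          dual_left.rep_eq)
  next
    have "((\<lambda>b. \<langle>bidual_embed b, bidual_right f \<Gamma>\<^sub>1\<rangle>) \<longlongrightarrow> \<langle>\<Gamma>\<^sub>2, bidual_right f \<Gamma>\<^sub>1\<rangle>) G" for f
      using G by (simp add: weak_star_lim_def)
    then show "weak_star_lim (\<lambda>b. arens2_dual \<Gamma>\<^sub>1 (bidual_embed b)) (arens2_dual \<Gamma>\<^sub>1 \<Gamma>\<^sub>2) G"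
      by (simp add: weak_star_lim_def arens2_dual.rep_eq)
  qed
  obtain F where F: "F \<noteq> bot" "weak_star_lim bidual_embed \<Gamma>\<^sub>1 F" by (rule weak_star_dense)
  obtain G where G: "G \<noteq> bot" "weak_star_lim bidual_embed \<Gamma>\<^sub>2 G" by (rule weak_star_dense)
  show ?thesis
  proof
    assume "is_arens2 \<Gamma>\<^sub>1 \<Gamma>\<^sub>2 P"
    then obtain \<Phi> where \<Phi>: "\<And>b. weak_star_lim (\<lambda>a. bidual_embed (a * b)) (\<Phi> b) F" "weak_star_lim \<Phi> P G"
      using F G unfolding is_arens2_def by blast
    have "\<Phi> = (\<lambda>b. arens2_dual \<Gamma>\<^sub>1 (bidual_embed b))"
      using weak_star_lim_unique[OF F(1) \<Phi>(1)] lims[OF F(2) G(2)] by blast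
    with \<Phi>(2) show "P = arens2_dual \<Gamma>\<^sub>1 \<Gamma>\<^sub>2"
      using weak_star_lim_unique[OF G(1)] lims[OF F(2) G(2)] by blast
  next
    assume "P = arens2_dual \<Gamma>\<^sub>1 \<Gamma>\<^sub>2"
    then show "is_arens2 \<Gamma>\<^sub>1 \<Gamma>\<^sub>2 P"
      unfolding is_arens2_def by (intro allI impI exI[of _ "\<lambda>b. arens2_dual \<Gamma>\<^sub>1 (bidual_embed b)"]) (simp only: lims simp_thms)
  qed
qed

lemma arens1_apply: "\<langle>\<Gamma>\<^sub>1 \<box> \<Gamma>\<^sub>2, f\<rangle> = \<langle>\<Gamma>\<^sub>1, bidual_left \<Gamma>\<^sub>2 f\<rangle>"
  by (simp add: arens1_def is_arens1_iff arens1_dual.rep_eq)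

lemma arens2_apply: "\<langle>\<Gamma>\<^sub>1 \<diamond> \<Gamma>\<^sub>2, f\<rangle> = \<langle>\<Gamma>\<^sub>2, bidual_right f \<Gamma>\<^sub>1\<rangle>"
  by (simp add: arens2_def is_arens2_iff arens2_dual.rep_eq)


section \<open>The space \<open>\<ell>\<^sup>1\<close>\<close>

lemma abs_summable_on_add:
  assumes "f abs_summable_on A" "g abs_summable_on A"
  shows "(\<lambda>x. f x + g x) abs_summable_on A"
  by (rule abs_summable_on_comparison_test'[OF summable_on_add[OF assms] norm_triangle_ineq])

lemma abs_summable_on_diff:
  assumes "f abs_summable_on A" "g abs_summable_on A"
  shows "(\<lambda>x. f x - g x) abs_summable_on A"
  by (rule abs_summable_on_comparison_test'[OF summable_on_add[OF assms] norm_triangle_ineq4])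

typedef 'a ell1 = "{f :: 'a \<Rightarrow> complex. f abs_summable_on UNIV}"
  morphisms ell1_coeff Abs_ell1
  by (rule exI[of _ "\<lambda>_. 0"]) simp

setup_lifting type_definition_ell1

lemma abs_summable_ell1_coeff: "ell1_coeff f abs_summable_on A"
  using ell1_coeff[of f] by (auto intro: summable_on_subset_banach)

lemma ell1_eqI: "(\<And>s. ell1_coeff f s = ell1_coeff g s) \<Longrightarrow> f = g"
  by (metis ell1_coeff_inject ext)

instantiation ell1 :: (type) complex_normed_vector
begin

lift_definition norm_ell1 :: "'a ell1 \<Rightarrow> real" is "\<lambda>f. \<Sum>\<^sub>\<infinity>s. cmod (f s)" .

lift_definition plus_ell1 :: "'a ell1 \<Rightarrow> 'a ell1 \<Rightarrow> 'a ell1" is "\<lambda>f g s. f s + g s"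
  by (rule abs_summable_on_add)

lift_definition minus_ell1 :: "'a ell1 \<Rightarrow> 'a ell1 \<Rightarrow> 'a ell1" is "\<lambda>f g s. f s - g s"
  by (rule abs_summable_on_diff)

lift_definition uminus_ell1 :: "'a ell1 \<Rightarrow> 'a ell1" is "\<lambda>f s. - f s"
  by simp

lift_definition zero_ell1 :: "'a ell1" is "\<lambda>_. 0"
  by simp

lift_definition scaleC_ell1 :: "complex \<Rightarrow> 'a ell1 \<Rightarrow> 'a ell1" is "\<lambda>c f s. c * f s"
  by (simp add: norm_mult summable_on_cmult_right)

definition scaleR_ell1 :: "real \<Rightarrow> 'a ell1 \<Rightarrow> 'a ell1"
  where "scaleR_ell1 r f = complex_of_real r *\<^sub>C f"

definition sgn_ell1 :: "'a ell1 \<Rightarrow> 'a ell1"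
  where "sgn_ell1 f = scaleR (inverse (norm f)) f"

definition dist_ell1 :: "'a ell1 \<Rightarrow> 'a ell1 \<Rightarrow> real"
  where "dist_ell1 f g = norm (f - g)"

definition uniformity_ell1 :: "('a ell1 \<times> 'a ell1) filter"
  where "uniformity_ell1 = (INF e\<in>{0 <..}. principal {(f, g). dist f g < e})"

definition open_ell1 :: "'a ell1 set \<Rightarrow> bool"
  where "open_ell1 U = (\<forall>f\<in>U. \<forall>\<^sub>F (f', g) in uniformity. f' = f \<longrightarrow> g \<in> U)"

instance
proof
  fix f g h :: "'a ell1" and r s :: real and c d :: complex
  show "f + g + h = f + (g + h)" "f + g = g + f" "0 + f = f" "- f + f = 0" "f - g = f + - g"
    by (transfer, simp add: fun_eq_iff)+
  have C: "c *\<^sub>C (f + g) = c *\<^sub>C f + c *\<^sub>C g" "(c + d) *\<^sub>C f = c *\<^sub>C f + d *\<^sub>C f"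
    "c *\<^sub>C d *\<^sub>C f = (c * d) *\<^sub>C f" "1 *\<^sub>C f = f" for c d and f g :: "'a ell1"
    by (transfer, simp add: fun_eq_iff algebra_simps)+
  show "c *\<^sub>C (f + g) = c *\<^sub>C f + c *\<^sub>C g" "(c + d) *\<^sub>C f = c *\<^sub>C f + d *\<^sub>C f"
    "c *\<^sub>C d *\<^sub>C f = (c * d) *\<^sub>C f" "1 *\<^sub>C f = f"
    by - (rule C)+
  show "r *\<^sub>R f = complex_of_real r *\<^sub>C f"
    by (simp add: scaleR_ell1_def)
  show "r *\<^sub>R (f + g) = r *\<^sub>R f + r *\<^sub>R g" "(r + s) *\<^sub>R f = r *\<^sub>R f + s *\<^sub>R f"
    "r *\<^sub>R s *\<^sub>R f = (r * s) *\<^sub>R f" "1 *\<^sub>R f = f"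
    by (simp_all add: scaleR_ell1_def C)
  show N: "norm (c *\<^sub>C f) = cmod c * norm f" for c
    by transfer (simp add: norm_mult infsum_cmult_right')
  show "norm (r *\<^sub>R f) = \<bar>r\<bar> * norm f"
    by (simp add: scaleR_ell1_def N)
  show "sgn f = inverse (norm f) *\<^sub>R f" "dist f g = norm (f - g)"
    by (simp_all add: sgn_ell1_def dist_ell1_def)
  show "uniformity = (INF e\<in>{0 <..}. principal {(f, g :: 'a ell1). dist f g < e})"
    by (simp add: uniformity_ell1_def)
  show "open U = (\<forall>f\<in>U. \<forall>\<^sub>F (f', g) in uniformity. f' = f \<longrightarrow> g \<in> U)" for U :: "'a ell1 set"
    by (simp add: open_ell1_def)
  show "norm f = 0 \<longleftrightarrow> f = 0"
  proof transfer
    fix f :: "'a \<Rightarrow> complex"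
    assume f: "f abs_summable_on UNIV"
    have "cmod (f s) \<le> (\<Sum>\<^sub>\<infinity>s. cmod (f s))" for s
      using finite_sum_le_infsum[of "\<lambda>s. cmod (f s)" UNIV "{s}"] f by simp
    then show "(\<Sum>\<^sub>\<infinity>s. cmod (f s)) = 0 \<longleftrightarrow> f = (\<lambda>_. 0)"
      by (auto simp: fun_eq_iff)
  qed
  show "norm (f + g) \<le> norm f + norm g"
  proof transfer
    fix f g :: "'a \<Rightarrow> complex"
    assume fg: "f abs_summable_on UNIV" "g abs_summable_on UNIV"
    then have s: "(\<lambda>s. cmod (f s) + cmod (g s)) summable_on UNIV"
      by (intro summable_on_add) auto
    have "(\<Sum>\<^sub>\<infinity>s. cmod (f s + g s)) \<le> (\<Sum>\<^sub>\<infinity>s. cmod (f s) + cmod (g s))"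
      by (intro infsum_mono abs_summable_on_comparison_test'[OF s] s) (auto simp: norm_triangle_ineq)
    also have "\<dots> = (\<Sum>\<^sub>\<infinity>s. cmod (f s)) + (\<Sum>\<^sub>\<infinity>s. cmod (g s))"
      using fg by (intro infsum_add) auto
    finally show "(\<Sum>\<^sub>\<infinity>s. cmod (f s + g s)) \<le> (\<Sum>\<^sub>\<infinity>s. cmod (f s)) + (\<Sum>\<^sub>\<infinity>s. cmod (g s))" .
  qed
qed

end

lemma sum_cmod_le_norm_ell1: "finite A \<Longrightarrow> (\<Sum>s\<in>A. cmod (ell1_coeff f s)) \<le> norm f"
  unfolding norm_ell1.rep_eq by (intro finite_sum_le_infsum abs_summable_ell1_coeff) auto

lemma cmod_ell1_coeff_le: "cmod (ell1_coeff f s) \<le> norm f"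
  using sum_cmod_le_norm_ell1[of "{s}" f] by simp

instance ell1 :: (type) banach
proof
  fix X :: "nat \<Rightarrow> 'a ell1"
  assume X: "Cauchy X"
  have "Cauchy (\<lambda>n. ell1_coeff (X n) s)" for s
  proof (rule metric_CauchyI)
    fix e :: real assume "e > 0"
    then obtain N where N: "\<And>m n. m \<ge> N \<Longrightarrow> n \<ge> N \<Longrightarrow> dist (X m) (X n) < e"
      using X metric_CauchyD by blast
    have "dist (ell1_coeff (X m) s) (ell1_coeff (X n) s) \<le> dist (X m) (X n)" for m n
      using cmod_ell1_coeff_le[of "X m - X n" s] by (simp add: dist_norm minus_ell1.rep_eq)
    then show "\<exists>N. \<forall>m\<ge>N. \<forall>n\<ge>N. dist (ell1_coeff (X m) s) (ell1_coeff (X n) s) < e"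
      using N by (meson le_less_trans)
  qed
  then have "\<forall>s. \<exists>l. (\<lambda>n. ell1_coeff (X n) s) \<longlonglongrightarrow> l"
    by (simp add: Cauchy_convergent_iff convergent_def)
  then obtain l where l: "\<And>s. (\<lambda>n. ell1_coeff (X n) s) \<longlonglongrightarrow> l s" by metis
  have bound: "(\<Sum>s\<in>A. cmod (ell1_coeff (X n) s - l s)) \<le> e"
    if "finite A" and N: "\<And>m. m \<ge> N \<Longrightarrow> dist (X n) (X m) < e" for A n N e
  proof (rule tendsto_upperbound)
    show "(\<lambda>m. \<Sum>s\<in>A. cmod (ell1_coeff (X n) s - ell1_coeff (X m) s))
        \<longlonglongrightarrow> (\<Sum>s\<in>A. cmod (ell1_coeff (X n) s - l s))"
      by (intro tendsto_intros l)
    have "(\<Sum>s\<in>A. cmod (ell1_coeff (X n) s - ell1_coeff (X m) s)) \<le> e" if "m \<ge> N" for m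
      using sum_cmod_le_norm_ell1[OF \<open>finite A\<close>, of "X n - X m"] N[OF that]
      by (simp add: dist_norm minus_ell1.rep_eq)
    then show "\<forall>\<^sub>F m in sequentially. (\<Sum>s\<in>A. cmod (ell1_coeff (X n) s - ell1_coeff (X m) s)) \<le> e"
      by (auto simp: eventually_sequentially)
  qed simp
  have summ: "(\<lambda>s. ell1_coeff (X n) s - l s) abs_summable_on UNIV"
    if N: "\<And>m. m \<ge> N \<Longrightarrow> dist (X n) (X m) < e" for n N e
    using bound[OF _ N] by (intro nonneg_bdd_above_summable_on bdd_aboveI2[where M = e]) auto
  obtain N0 where N0: "\<And>m n. m \<ge> N0 \<Longrightarrow> n \<ge> N0 \<Longrightarrow> dist (X m) (X n) < 1"
    using X metric_CauchyD[of X 1] by auto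
  have "(\<lambda>s. ell1_coeff (X N0) s - (ell1_coeff (X N0) s - l s)) abs_summable_on UNIV"
    using N0 by (intro abs_summable_on_diff abs_summable_ell1_coeff summ[of N0 N0 1]) auto
  then have L: "ell1_coeff (Abs_ell1 l) = l" by (simp add: Abs_ell1_inverse)
  have "X \<longlonglongrightarrow> Abs_ell1 l"
  proof (rule metric_LIMSEQ_I)
    fix e :: real assume "e > 0"
    then obtain N where N: "\<And>m n. m \<ge> N \<Longrightarrow> n \<ge> N \<Longrightarrow> dist (X m) (X n) < e / 2"
      using X metric_CauchyD[of X "e / 2"] by auto
    have "dist (X n) (Abs_ell1 l) < e" if "n \<ge> N" for n
    proof -
      have n: "\<And>m. m \<ge> N \<Longrightarrow> dist (X n) (X m) < e / 2" using N that by blast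
      have s: "(\<lambda>s. ell1_coeff (X n) s - l s) abs_summable_on UNIV"
        using n by (rule summ)
      have "(\<Sum>s\<in>A. cmod (ell1_coeff (X n) s - l s)) \<le> e / 2" if "finite A" for A
        using that n by (rule bound)
      then have "dist (X n) (Abs_ell1 l) \<le> e / 2"
        unfolding dist_norm norm_ell1.rep_eq minus_ell1.rep_eq L
        by (intro infsum_le_finite_sums[OF s])
      with \<open>e > 0\<close> show ?thesis by simp
    qed
    then show "\<exists>N. \<forall>n\<ge>N. dist (X n) (Abs_ell1 l) < e" by blast
  qed
  then show "convergent X" by (auto simp: convergent_def)
qed

lift_definition point_mass :: "'a \<Rightarrow> 'a ell1" ("\<delta>") is "\<lambda>s t. if t = s then 1 else 0"
proof -
  fix s :: 'a
  have "(\<lambda>t. cmod (if t = s then 1 else 0)) summable_on {s}" by simp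
  then have "(\<lambda>t. cmod (if t = s then 1 else 0)) summable_on UNIV"
    by (rule summable_on_cong_neutral[THEN iffD1, rotated 3]) auto
  then show "(\<lambda>t. if t = s then 1 else 0 :: complex) abs_summable_on UNIV" .
qed

definition ell1_on :: "'a set \<Rightarrow> 'a ell1 set"
  where "ell1_on A = {f. \<forall>s. s \<notin> A \<longrightarrow> ell1_coeff f s = 0}"

lemma infsum_fibres:
  fixes h :: "'x \<Rightarrow> 'b::banach"
  assumes "h summable_on UNIV"
  shows "(\<lambda>u. \<Sum>\<^sub>\<infinity>x\<in>{x. \<phi> x = u}. h x) summable_on UNIV"
    and "(\<Sum>\<^sub>\<infinity>u. \<Sum>\<^sub>\<infinity>x\<in>{x. \<phi> x = u}. h x) = infsum h UNIV"
proof -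
  have S: "Sigma UNIV (\<lambda>u. {x. \<phi> x = u}) = (\<lambda>x. (\<phi> x, x)) ` UNIV" by auto
  have inj: "inj (\<lambda>x. (\<phi> x, x))" by (auto simp: inj_def)
  have s: "(\<lambda>(u, x). h x) summable_on Sigma UNIV (\<lambda>u. {x. \<phi> x = u})"
    unfolding S using assms by (subst summable_on_reindex[OF inj]) (simp add: o_def)
  show "(\<lambda>u. \<Sum>\<^sub>\<infinity>x\<in>{x. \<phi> x = u}. h x) summable_on UNIV"
    using summable_on_Sigma_banach[OF s] .
  have "infsum (\<lambda>(u, x). h x) (Sigma UNIV (\<lambda>u. {x. \<phi> x = u})) = infsum h UNIV"
    unfolding S by (subst infsum_reindex[OF inj]) (simp add: o_def)
  then show "(\<Sum>\<^sub>\<infinity>u. \<Sum>\<^sub>\<infinity>x\<in>{x. \<phi> x = u}. h x) = infsum h UNIV"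
    using infsum_Sigma'_banach[OF s] by simp
qed

lemma abs_summable_prod_ell1:
  "(\<lambda>(s, t). ell1_coeff f s * ell1_coeff g t) abs_summable_on UNIV"
proof -
  have "(\<lambda>(s, t). ell1_coeff f s * ell1_coeff g t) abs_summable_on UNIV \<times> UNIV"
    unfolding abs_summable_on_Sigma_iff
    using abs_summable_ell1_coeff[of f] abs_summable_ell1_coeff[of g]
    by (auto simp: norm_mult infsum_cmult_right' summable_on_cmult_right summable_on_cmult_left
        abs_mult infsum_nonneg)
  then show ?thesis by simp
qed

lemma infsum_prod_ell1:
  assumes "\<And>s t. cmod (k s t) \<le> K"
  shows "(\<lambda>(s, t). ell1_coeff f s * ell1_coeff g t * k s t) abs_summable_on UNIV"
    and "(\<Sum>\<^sub>\<infinity>(s, t). ell1_coeff f s * ell1_coeff g t * k s t) =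
      (\<Sum>\<^sub>\<infinity>s. ell1_coeff f s * (\<Sum>\<^sub>\<infinity>t. ell1_coeff g t * k s t))"
proof -
  have "(\<lambda>p. norm (case p of (s, t) \<Rightarrow> ell1_coeff f s * ell1_coeff g t) * K) summable_on UNIV"
    using abs_summable_prod_ell1 by (rule summable_on_cmult_left)
  then show s: "(\<lambda>(s, t). ell1_coeff f s * ell1_coeff g t * k s t) abs_summable_on UNIV"
    by (rule abs_summable_on_comparison_test') (auto simp: norm_mult intro!: mult_left_mono assms)
  then have "(\<lambda>(s, t). ell1_coeff f s * ell1_coeff g t * k s t) summable_on UNIV \<times> UNIV"
    using abs_summable_summable by fastforce
  from infsum_Sigma'_banach[OF this]
  show "(\<Sum>\<^sub>\<infinity>(s, t). ell1_coeff f s * ell1_coeff g t * k s t) =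
      (\<Sum>\<^sub>\<infinity>s. ell1_coeff f s * (\<Sum>\<^sub>\<infinity>t. ell1_coeff g t * k s t))"
    by (simp add: mult.assoc infsum_cmult_right')
qed

text \<open>
  The bounded bilinear extension of \<open>(\<delta>\<^sub>s, \<delta>\<^sub>t) \<mapsto> \<delta>\<^bsub>\<phi>(s,t)\<^esub>\<close>:
  convolution and both actions of \<open>\<ell>\<^sup>1(E)\<close> are instances of it.
\<close>

lift_definition bilinear_ext :: "('a \<Rightarrow> 'b \<Rightarrow> 'c) \<Rightarrow> 'a ell1 \<Rightarrow> 'b ell1 \<Rightarrow> 'c ell1"
  is "\<lambda>\<phi> f g u. \<Sum>\<^sub>\<infinity>(s, t)\<in>{(s, t). \<phi> s t = u}. f s * g t"
proof -
  fix \<phi> :: "'a \<Rightarrow> 'b \<Rightarrow> 'c" and f :: "'a \<Rightarrow> complex" and g :: "'b \<Rightarrow> complex"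
  assume f: "f abs_summable_on UNIV" and g: "g abs_summable_on UNIV"
  define h where "h = (\<lambda>(s, t). f s * g t)"
  have h: "h abs_summable_on UNIV"
    using abs_summable_prod_ell1[of "Abs_ell1 f" "Abs_ell1 g"] f g
    by (simp add: h_def Abs_ell1_inverse)
  have eq: "{(s, t). \<phi> s t = u} = {x. case_prod \<phi> x = u}" for u by auto
  have "(\<lambda>u. \<Sum>\<^sub>\<infinity>x\<in>{x. case_prod \<phi> x = u}. norm (h x)) summable_on UNIV"
    using h by (rule infsum_fibres(1))
  then have "(\<lambda>u. \<Sum>\<^sub>\<infinity>x\<in>{x. case_prod \<phi> x = u}. h x) abs_summable_on UNIV"
    by (rule abs_summable_on_comparison_test')
      (intro norm_infsum_bound summable_on_subset_banach[OF h] subset_UNIV)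
  then show "(\<lambda>u. \<Sum>\<^sub>\<infinity>(s, t)\<in>{(s, t). \<phi> s t = u}. f s * g t) abs_summable_on UNIV"
    by (simp add: eq h_def)
qed

lemma bilinear_ext_test:
  assumes k: "\<And>u. cmod (k u) \<le> K"
  shows "(\<Sum>\<^sub>\<infinity>u. ell1_coeff (bilinear_ext \<phi> f g) u * k u) =
    (\<Sum>\<^sub>\<infinity>s. ell1_coeff f s * (\<Sum>\<^sub>\<infinity>t. ell1_coeff g t * k (\<phi> s t)))"
proof -
  define h where "h = (\<lambda>(s, t). ell1_coeff f s * ell1_coeff g t * k (\<phi> s t))"
  have h: "h abs_summable_on UNIV"
    unfolding h_def by (rule infsum_prod_ell1[where K = K]) (rule k)
  have "ell1_coeff (bilinear_ext \<phi> f g) u * k u = (\<Sum>\<^sub>\<infinity>x\<in>{x. case_prod \<phi> x = u}. h x)" for u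
  proof -
    have "ell1_coeff (bilinear_ext \<phi> f g) u * k u =
        (\<Sum>\<^sub>\<infinity>x\<in>{x. case_prod \<phi> x = u}. (case x of (s, t) \<Rightarrow> ell1_coeff f s * ell1_coeff g t) * k u)"
      by (simp add: bilinear_ext.rep_eq infsum_cmult_left' case_prod_unfold)
    also have "\<dots> = (\<Sum>\<^sub>\<infinity>x\<in>{x. case_prod \<phi> x = u}. h x)"
      by (rule infsum_cong) (auto simp: h_def)
    finally show ?thesis .
  qed
  then have "(\<Sum>\<^sub>\<infinity>u. ell1_coeff (bilinear_ext \<phi> f g) u * k u) = infsum h UNIV"
    using infsum_fibres(2)[OF abs_summable_summable[OF h]] by simp
  then show ?thesis
    unfolding h_def using infsum_prod_ell1(2)[of "\<lambda>s t. k (\<phi> s t)" K f g] k by simp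
qed

lemma infsum_point_mass: "(\<Sum>\<^sub>\<infinity>t. ell1_coeff (\<delta> s) t * k t) = k s"
proof -
  have "(\<Sum>\<^sub>\<infinity>t. ell1_coeff (\<delta> s) t * k t) = (\<Sum>\<^sub>\<infinity>t\<in>{s}. k t)"
    by (rule infsum_cong_neutral) (auto simp: point_mass.rep_eq)
  then show ?thesis by simp
qed

lemma infsum_indicator: "(\<Sum>\<^sub>\<infinity>t. ell1_coeff f t * (if t = s then 1 else 0)) = ell1_coeff f s"
proof -
  have "(\<Sum>\<^sub>\<infinity>t. ell1_coeff f t * (if t = s then 1 else 0)) = (\<Sum>\<^sub>\<infinity>t\<in>{s}. ell1_coeff f t)"
    by (rule infsum_cong_neutral) auto
  then show ?thesis by simp
qed

lemma ell1_eqI_test: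
  assumes "\<And>k :: 'a \<Rightarrow> complex. (\<And>u. cmod (k u) \<le> 1) \<Longrightarrow>
    (\<Sum>\<^sub>\<infinity>u. ell1_coeff f u * k u) = (\<Sum>\<^sub>\<infinity>u. ell1_coeff g u * k u)"
  shows "f = g"
proof (rule ell1_eqI)
  fix s
  show "ell1_coeff f s = ell1_coeff g s"
    using assms[of "\<lambda>t. if t = s then 1 else 0"] by (simp add: infsum_indicator)
qed

lemma ell1_test_bounded:
  assumes "\<And>u. cmod (k u) \<le> 1"
  shows "cmod (\<Sum>\<^sub>\<infinity>t. ell1_coeff g t * k t) \<le> norm g"
    and "(\<lambda>t. ell1_coeff g t * k t) summable_on UNIV"
proof -
  have le: "cmod (ell1_coeff g t * k t) \<le> cmod (ell1_coeff g t)" for t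
    using mult_left_mono[OF assms[of t], of "cmod (ell1_coeff g t)"] by (simp add: norm_mult)
  have s: "(\<lambda>t. ell1_coeff g t * k t) abs_summable_on UNIV"
    by (rule abs_summable_on_comparison_test'[OF abs_summable_ell1_coeff le])
  then show "(\<lambda>t. ell1_coeff g t * k t) summable_on UNIV"
    by (rule abs_summable_summable)
  have "cmod (\<Sum>\<^sub>\<infinity>t. ell1_coeff g t * k t) \<le> (\<Sum>\<^sub>\<infinity>t. cmod (ell1_coeff g t * k t))"
    using s by (rule norm_infsum_bound)
  also have "\<dots> \<le> norm g"
    unfolding norm_ell1.rep_eq by (intro infsum_mono s abs_summable_ell1_coeff le)
  finally show "cmod (\<Sum>\<^sub>\<infinity>t. ell1_coeff g t * k t) \<le> norm g" .
qed

lemma bilinear_ext_point_mass: "bilinear_ext \<phi> (\<delta> s) (\<delta> t) = \<delta> (\<phi> s t)"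
  by (rule ell1_eqI_test) (simp add: bilinear_ext_test[where K = 1] infsum_point_mass)

lemma bilinear_ext_assoc:
  fixes \<phi> :: "'x \<Rightarrow> 'c \<Rightarrow> 'd" and \<psi> :: "'a \<Rightarrow> 'b \<Rightarrow> 'x"
    and \<phi>' :: "'a \<Rightarrow> 'y \<Rightarrow> 'd" and \<psi>' :: "'b \<Rightarrow> 'c \<Rightarrow> 'y"
  assumes "\<And>s t u. \<phi> (\<psi> s t) u = \<phi>' s (\<psi>' t u)"
  shows "bilinear_ext \<phi> (bilinear_ext \<psi> f g) h = bilinear_ext \<phi>' f (bilinear_ext \<psi>' g h)"
proof (rule ell1_eqI_test)
  fix k :: "'d \<Rightarrow> complex" assume k: "\<And>u. cmod (k u) \<le> 1"
  show "(\<Sum>\<^sub>\<infinity>u. ell1_coeff (bilinear_ext \<phi> (bilinear_ext \<psi> f g) h) u * k u) =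
      (\<Sum>\<^sub>\<infinity>u. ell1_coeff (bilinear_ext \<phi>' f (bilinear_ext \<psi>' g h)) u * k u)"
    using ell1_test_bounded(1)[of "\<lambda>u. k (\<phi> _ u)" h] k
    by (simp add: bilinear_ext_test[where K = "norm h"] bilinear_ext_test[where K = 1] assms)
qed

lemma bilinear_ext_add:
  fixes \<phi> :: "'a \<Rightarrow> 'b \<Rightarrow> 'c"
  shows "bilinear_ext \<phi> (f + f') g = bilinear_ext \<phi> f g + bilinear_ext \<phi> f' g"
  "bilinear_ext \<phi> f (g + g') = bilinear_ext \<phi> f g + bilinear_ext \<phi> f g'"
proof -
  have s: "(\<lambda>(s, t). ell1_coeff f s * ell1_coeff g t) summable_on A" for A and f :: "'a ell1" and g :: "'b ell1"
    using abs_summable_summable[OF abs_summable_prod_ell1] by (rule summable_on_subset_banach) simp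
  have add: "(\<Sum>\<^sub>\<infinity>(s, t)\<in>A. ell1_coeff f s * ell1_coeff g t + ell1_coeff f' s * ell1_coeff g' t) =
      (\<Sum>\<^sub>\<infinity>(s, t)\<in>A. ell1_coeff f s * ell1_coeff g t) + (\<Sum>\<^sub>\<infinity>(s, t)\<in>A. ell1_coeff f' s * ell1_coeff g' t)"
    for A and f f' :: "'a ell1" and g g' :: "'b ell1"
    using infsum_add[OF s[of f g A] s[of f' g' A]] by (simp add: case_prod_unfold)
  show "bilinear_ext \<phi> (f + f') g = bilinear_ext \<phi> f g + bilinear_ext \<phi> f' g"
    by (rule ell1_eqI) (simp add: bilinear_ext.rep_eq plus_ell1.rep_eq add distrib_right)
  show "bilinear_ext \<phi> f (g + g') = bilinear_ext \<phi> f g + bilinear_ext \<phi> f g'"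
    by (rule ell1_eqI) (simp add: bilinear_ext.rep_eq plus_ell1.rep_eq add distrib_left)
qed

lemma bilinear_ext_scaleC:
  "bilinear_ext \<phi> (c *\<^sub>C f) g = c *\<^sub>C bilinear_ext \<phi> f g"
  "bilinear_ext \<phi> f (c *\<^sub>C g) = c *\<^sub>C bilinear_ext \<phi> f g"
  by (rule ell1_eqI; simp add: bilinear_ext.rep_eq scaleC_ell1.rep_eq infsum_cmult_right'[symmetric]
      case_prod_unfold mult_ac)+

lemma norm_bilinear_ext: "norm (bilinear_ext \<phi> f g) \<le> norm f * norm g"
proof -
  define k where "k u = cnj (sgn (ell1_coeff (bilinear_ext \<phi> f g) u))" for u
  have k: "cmod (k u) \<le> 1" for u by (simp add: k_def norm_sgn)
  have kk: "ell1_coeff (bilinear_ext \<phi> f g) u * k u = of_real (cmod (ell1_coeff (bilinear_ext \<phi> f g) u))" for u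
    by (simp add: k_def sgn_eq complex_norm_square[symmetric] power2_eq_square)
  have "complex_of_real (norm (bilinear_ext \<phi> f g)) = (\<Sum>\<^sub>\<infinity>u. ell1_coeff (bilinear_ext \<phi> f g) u * k u)"
    unfolding kk norm_ell1.rep_eq
    by (intro infsumI[symmetric] has_sum_bounded_linear[OF bounded_linear_of_real]
        has_sum_infsum abs_summable_ell1_coeff)
  also have "\<dots> = (\<Sum>\<^sub>\<infinity>s. ell1_coeff f s * (\<Sum>\<^sub>\<infinity>t. ell1_coeff g t * k (\<phi> s t)))"
    using k by (rule bilinear_ext_test)
  finally have *: "norm (bilinear_ext \<phi> f g) = cmod (\<Sum>\<^sub>\<infinity>s. ell1_coeff f s * (\<Sum>\<^sub>\<infinity>t. ell1_coeff g t * k (\<phi> s t)))"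
    by (metis abs_norm_cancel norm_of_real)
  have le: "cmod (ell1_coeff f s * (\<Sum>\<^sub>\<infinity>t. ell1_coeff g t * k (\<phi> s t))) \<le> cmod (ell1_coeff f s) * norm g" for s
    unfolding norm_mult by (intro mult_left_mono ell1_test_bounded k) auto
  have sg: "(\<lambda>s. cmod (ell1_coeff f s) * norm g) summable_on UNIV"
    by (intro summable_on_cmult_left abs_summable_ell1_coeff)
  have s: "(\<lambda>s. ell1_coeff f s * (\<Sum>\<^sub>\<infinity>t. ell1_coeff g t * k (\<phi> s t))) abs_summable_on UNIV"
    by (rule abs_summable_on_comparison_test'[OF sg le])
  have "norm (bilinear_ext \<phi> f g) \<le> (\<Sum>\<^sub>\<infinity>s. cmod (ell1_coeff f s * (\<Sum>\<^sub>\<infinity>t. ell1_coeff g t * k (\<phi> s t))))"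
    unfolding * using s by (rule norm_infsum_bound)
  also have "\<dots> \<le> (\<Sum>\<^sub>\<infinity>s. cmod (ell1_coeff f s) * norm g)"
    by (intro infsum_mono s sg le)
  also have "\<dots> = norm f * norm g"
    by (simp add: infsum_cmult_left' norm_ell1.rep_eq)
  finally show ?thesis .
qed

instantiation ell1 :: (semigroup_mult) complex_banach_algebra
begin

definition times_ell1 :: "'a ell1 \<Rightarrow> 'a ell1 \<Rightarrow> 'a ell1"
  where "f * g = bilinear_ext (*) f g"

instance
proof
  fix f g h :: "'a ell1" and c :: complex and r :: real
  show "f * g * h = f * (g * h)"
    unfolding times_ell1_def by (rule bilinear_ext_assoc) (rule mult.assoc)
  show "(f + g) * h = f * h + g * h" "f * (g + h) = f * g + f * h"
    by (simp_all add: times_ell1_def bilinear_ext_add)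
  show "c *\<^sub>C f * g = c *\<^sub>C (f * g)" "f * c *\<^sub>C g = c *\<^sub>C (f * g)"
    "r *\<^sub>R f * g = r *\<^sub>R (f * g)" "f * r *\<^sub>R g = r *\<^sub>R (f * g)"
    by (simp_all add: times_ell1_def bilinear_ext_scaleC scaleR_scaleC)
  show "norm (f * g) \<le> norm f * norm g"
    unfolding times_ell1_def by (rule norm_bilinear_ext)
qed

end


section \<open>Upper triangular matrices\<close>

datatype 'a tri = Tri (tri11: 'a) (tri12: 'a) (tri22: 'a)

instantiation tri :: (complex_normed_vector) complex_normed_vector
begin

definition zero_tri :: "'a tri" where "0 = Tri 0 0 0"

definition plus_tri :: "'a tri \<Rightarrow> 'a tri \<Rightarrow> 'a tri"
  where "A + B = Tri (tri11 A + tri11 B) (tri12 A + tri12 B) (tri22 A + tri22 B)"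

definition minus_tri :: "'a tri \<Rightarrow> 'a tri \<Rightarrow> 'a tri"
  where "A - B = Tri (tri11 A - tri11 B) (tri12 A - tri12 B) (tri22 A - tri22 B)"

definition uminus_tri :: "'a tri \<Rightarrow> 'a tri"
  where "- A = Tri (- tri11 A) (- tri12 A) (- tri22 A)"

definition scaleC_tri :: "complex \<Rightarrow> 'a tri \<Rightarrow> 'a tri"
  where "c *\<^sub>C A = Tri (c *\<^sub>C tri11 A) (c *\<^sub>C tri12 A) (c *\<^sub>C tri22 A)"

definition scaleR_tri :: "real \<Rightarrow> 'a tri \<Rightarrow> 'a tri"
  where "scaleR_tri r A = complex_of_real r *\<^sub>C A"

definition norm_tri :: "'a tri \<Rightarrow> real"
  where "norm A = norm (tri11 A) + norm (tri12 A) + norm (tri22 A)"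

definition sgn_tri :: "'a tri \<Rightarrow> 'a tri"
  where "sgn_tri A = scaleR (inverse (norm A)) A"

definition dist_tri :: "'a tri \<Rightarrow> 'a tri \<Rightarrow> real"
  where "dist_tri A B = norm (A - B)"

definition uniformity_tri :: "('a tri \<times> 'a tri) filter"
  where "uniformity_tri = (INF e\<in>{0 <..}. principal {(A, B). dist A B < e})"

definition open_tri :: "'a tri set \<Rightarrow> bool"
  where "open_tri U = (\<forall>A\<in>U. \<forall>\<^sub>F (A', B) in uniformity. A' = A \<longrightarrow> B \<in> U)"

instance
proof
  fix A B D :: "'a tri" and r s :: real and c d :: complex
  show "A + B + D = A + (B + D)" "A + B = B + A" "0 + A = A" "- A + A = 0" "A - B = A + - B"
    by (simp_all add: zero_tri_def plus_tri_def minus_tri_def uminus_tri_def add.commute add.assoc)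
  have C: "c *\<^sub>C (A + B) = c *\<^sub>C A + c *\<^sub>C B" "(c + d) *\<^sub>C A = c *\<^sub>C A + d *\<^sub>C A"
    "c *\<^sub>C d *\<^sub>C A = (c * d) *\<^sub>C A" "1 *\<^sub>C A = A" for c d and A B :: "'a tri"
    by (simp_all add: plus_tri_def scaleC_tri_def scaleC_add_right scaleC_add_left scaleC_scaleC scaleC_one)
  show "c *\<^sub>C (A + B) = c *\<^sub>C A + c *\<^sub>C B" "(c + d) *\<^sub>C A = c *\<^sub>C A + d *\<^sub>C A"
    "c *\<^sub>C d *\<^sub>C A = (c * d) *\<^sub>C A" "1 *\<^sub>C A = A"
    by - (rule C)+
  show "r *\<^sub>R A = complex_of_real r *\<^sub>C A"
    by (simp add: scaleR_tri_def)
  show "r *\<^sub>R (A + B) = r *\<^sub>R A + r *\<^sub>R B" "(r + s) *\<^sub>R A = r *\<^sub>R A + s *\<^sub>R A"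
    "r *\<^sub>R s *\<^sub>R A = (r * s) *\<^sub>R A" "1 *\<^sub>R A = A"
    by (simp_all add: scaleR_tri_def C)
  show N: "norm (c *\<^sub>C A) = cmod c * norm A" for c
    by (simp add: norm_tri_def scaleC_tri_def norm_scaleC distrib_left)
  show "norm (r *\<^sub>R A) = \<bar>r\<bar> * norm A"
    by (simp add: scaleR_tri_def N)
  show "sgn A = inverse (norm A) *\<^sub>R A" "dist A B = norm (A - B)"
    by (simp_all add: sgn_tri_def dist_tri_def)
  show "uniformity = (INF e\<in>{0 <..}. principal {(A, B :: 'a tri). dist A B < e})"
    by (simp add: uniformity_tri_def)
  show "open U = (\<forall>A\<in>U. \<forall>\<^sub>F (A', B) in uniformity. A' = A \<longrightarrow> B \<in> U)" for U :: "'a tri set"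
    by (simp add: open_tri_def)
  show "norm A = 0 \<longleftrightarrow> A = 0"
    by (cases A) (simp add: norm_tri_def zero_tri_def add_nonneg_eq_0_iff)
  show "norm (A + B) \<le> norm A + norm B"
    using norm_triangle_ineq[of "tri11 A" "tri11 B"] norm_triangle_ineq[of "tri12 A" "tri12 B"]
      norm_triangle_ineq[of "tri22 A" "tri22 B"]
    by (simp add: norm_tri_def plus_tri_def)
qed

end

lemma bounded_linear_tri_entries: "bounded_linear tri11" "bounded_linear tri12" "bounded_linear tri22"
  by (rule bounded_linear_intro[where K = 1];
      simp add: plus_tri_def scaleR_tri_def scaleC_tri_def scaleR_scaleC norm_tri_def)+

instance tri :: (complex_banach_algebra) banach
proof
  fix X :: "nat \<Rightarrow> 'a tri"
  assume X: "Cauchy X"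
  have "convergent (\<lambda>n. tri11 (X n))" "convergent (\<lambda>n. tri12 (X n))" "convergent (\<lambda>n. tri22 (X n))"
    using X by (auto intro!: Cauchy_convergent intro: bounded_linear.Cauchy bounded_linear_tri_entries)
  then obtain a m b where "(\<lambda>n. tri11 (X n)) \<longlonglongrightarrow> a" "(\<lambda>n. tri12 (X n)) \<longlonglongrightarrow> m" "(\<lambda>n. tri22 (X n)) \<longlonglongrightarrow> b"
    unfolding convergent_def by blast
  then have "(\<lambda>n. norm (tri11 (X n) - a) + norm (tri12 (X n) - m) + norm (tri22 (X n) - b)) \<longlonglongrightarrow> 0 + 0 + 0"
    by (intro tendsto_add tendsto_norm_zero) (simp_all add: LIM_zero)
  then have "(\<lambda>n. norm (X n - Tri a m b)) \<longlonglongrightarrow> 0"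
    by (simp add: norm_tri_def minus_tri_def)
  then have "X \<longlonglongrightarrow> Tri a m b"
    by (metis LIM_zero_cancel tendsto_norm_zero_iff)
  then show "convergent X" by (auto simp: convergent_def)
qed

instantiation tri :: (complex_banach_algebra) complex_banach_algebra
begin

definition times_tri :: "'a tri \<Rightarrow> 'a tri \<Rightarrow> 'a tri"
  where "A * B = Tri (tri11 A * tri11 B) (tri11 A * tri12 B + tri12 A * tri22 B) (tri22 A * tri22 B)"

instance
proof
  fix A B D :: "'a tri" and c :: complex and r :: real
  show "A * B * D = A * (B * D)" "(A + B) * D = A * D + B * D" "A * (B + D) = A * B + A * D"
    by (simp_all add: times_tri_def plus_tri_def algebra_simps)
  show "c *\<^sub>C A * B = c *\<^sub>C (A * B)" "A * c *\<^sub>C B = c *\<^sub>C (A * B)"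
    "r *\<^sub>R A * B = r *\<^sub>R (A * B)" "A * r *\<^sub>R B = r *\<^sub>R (A * B)"
    by (simp_all add: times_tri_def scaleC_tri_def scaleR_scaleC mult_scaleC_left mult_scaleC_right
        scaleC_add_right)
  obtain a m b where A: "A = Tri a m b" by (cases A)
  obtain a' m' b' where B: "B = Tri a' m' b'" by (cases B)
  have "norm (A * B) \<le> norm (a * a') + (norm (a * m') + norm (m * b')) + norm (b * b')"
    by (simp add: A B norm_tri_def times_tri_def norm_triangle_ineq)
  also have "\<dots> \<le> norm a * norm a' + (norm a * norm m' + norm m * norm b') + norm b * norm b'"
    by (intro add_mono norm_mult_ineq)
  also have "\<dots> \<le> norm A * norm B"
    by (simp add: A B norm_tri_def algebra_simps)
  finally show "norm (A * B) \<le> norm A * norm B" .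
qed

end


section \<open>Banach modules and module Arens regularity\<close>

text \<open>The acting algebra is given as a closed subalgebra of a Banach algebra.\<close>

locale banach_bimodule =
  fixes \<AA> :: "'b::complex_banach_algebra set"
    and lact :: "'b \<Rightarrow> 'a \<Rightarrow> 'a::complex_banach_algebra" (infixr "\<rhd>" 75)
    and ract :: "'a \<Rightarrow> 'b \<Rightarrow> 'a" (infixl "\<lhd>" 75)
  assumes closed_subalgebra: "closed \<AA>" "csubspace \<AA>" "\<alpha> \<in> \<AA> \<Longrightarrow> \<beta> \<in> \<AA> \<Longrightarrow> \<alpha> * \<beta> \<in> \<AA>"
    and lact_bilinear: "\<alpha> \<in> \<AA> \<Longrightarrow> \<beta> \<in> \<AA> \<Longrightarrow> (\<alpha> + \<beta>) \<rhd> a = \<alpha> \<rhd> a + \<beta> \<rhd> a"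
      "\<alpha> \<in> \<AA> \<Longrightarrow> \<alpha> \<rhd> (a + b) = \<alpha> \<rhd> a + \<alpha> \<rhd> b"
      "\<alpha> \<in> \<AA> \<Longrightarrow> (c *\<^sub>C \<alpha>) \<rhd> a = c *\<^sub>C (\<alpha> \<rhd> a)" "\<alpha> \<in> \<AA> \<Longrightarrow> \<alpha> \<rhd> (c *\<^sub>C a) = c *\<^sub>C (\<alpha> \<rhd> a)"
    and ract_bilinear: "\<alpha> \<in> \<AA> \<Longrightarrow> \<beta> \<in> \<AA> \<Longrightarrow> a \<lhd> (\<alpha> + \<beta>) = a \<lhd> \<alpha> + a \<lhd> \<beta>"
      "\<alpha> \<in> \<AA> \<Longrightarrow> (a + b) \<lhd> \<alpha> = a \<lhd> \<alpha> + b \<lhd> \<alpha>"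
      "\<alpha> \<in> \<AA> \<Longrightarrow> a \<lhd> (c *\<^sub>C \<alpha>) = c *\<^sub>C (a \<lhd> \<alpha>)" "\<alpha> \<in> \<AA> \<Longrightarrow> (c *\<^sub>C a) \<lhd> \<alpha> = c *\<^sub>C (a \<lhd> \<alpha>)"
    and act_bounded: "\<exists>K. \<forall>\<alpha>\<in>\<AA>. \<forall>a. norm (\<alpha> \<rhd> a) \<le> K * norm \<alpha> * norm a"
      "\<exists>K. \<forall>\<alpha>\<in>\<AA>. \<forall>a. norm (a \<lhd> \<alpha>) \<le> K * norm \<alpha> * norm a"
    and bimodule: "\<alpha> \<in> \<AA> \<Longrightarrow> \<beta> \<in> \<AA> \<Longrightarrow> (\<alpha> * \<beta>) \<rhd> a = \<alpha> \<rhd> (\<beta> \<rhd> a)"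
      "\<alpha> \<in> \<AA> \<Longrightarrow> \<beta> \<in> \<AA> \<Longrightarrow> a \<lhd> (\<alpha> * \<beta>) = (a \<lhd> \<alpha>) \<lhd> \<beta>"
      "\<alpha> \<in> \<AA> \<Longrightarrow> \<beta> \<in> \<AA> \<Longrightarrow> (\<alpha> \<rhd> a) \<lhd> \<beta> = \<alpha> \<rhd> (a \<lhd> \<beta>)"
    and compatible: "\<alpha> \<in> \<AA> \<Longrightarrow> \<alpha> \<rhd> (a * b) = (\<alpha> \<rhd> a) * b" "\<alpha> \<in> \<AA> \<Longrightarrow> (a * b) \<lhd> \<alpha> = a * (b \<lhd> \<alpha>)"

definition closed_ideal :: "'a::complex_normed_algebra set \<Rightarrow> bool"
  where "closed_ideal I \<longleftrightarrow> closed I \<and> csubspace I \<and> (\<forall>x\<in>I. \<forall>a. a * x \<in> I \<and> x * a \<in> I)"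

definition closed_ideal_generated :: "'a::complex_normed_algebra set \<Rightarrow> 'a set"
  where "closed_ideal_generated X = \<Inter>{I. closed_ideal I \<and> X \<subseteq> I}"

definition module_ideal ::
  "'b set \<Rightarrow> ('b \<Rightarrow> 'a \<Rightarrow> 'a) \<Rightarrow> ('a \<Rightarrow> 'b \<Rightarrow> 'a) \<Rightarrow> 'a::complex_banach_algebra set"
  where "module_ideal \<AA> lact ract =
    closed_ideal_generated {ract a \<alpha> * b - a * lact \<alpha> b | a \<alpha> b. \<alpha> \<in> \<AA>}"

definition module_arens_regular ::
  "'b set \<Rightarrow> ('b \<Rightarrow> 'a \<Rightarrow> 'a) \<Rightarrow> ('a \<Rightarrow> 'b \<Rightarrow> 'a::complex_banach_algebra) \<Rightarrow> bool"
  where "module_arens_regular \<AA> lact ract \<longleftrightarrow>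
    (\<forall>\<Gamma>\<^sub>1 \<Gamma>\<^sub>2 :: 'a cdual cdual.
      \<Gamma>\<^sub>1 \<box> \<Gamma>\<^sub>2 - \<Gamma>\<^sub>1 \<diamond> \<Gamma>\<^sub>2 \<in> annihilator (annihilator (module_ideal \<AA> lact ract)))"


section \<open>Inverse semigroups\<close>

class inverse_semigroup = semigroup_mult +
  assumes ex1_star: "\<exists>!t. s * t * s = s \<and> t * s * t = t"

definition star :: "'s::inverse_semigroup \<Rightarrow> 's"
  where "star s = (THE t. s * t * s = s \<and> t * s * t = t)"

definition idempotents :: "'s::inverse_semigroup set"
  where "idempotents = {e. e = star e \<and> e = e * e}"

lemma star_eqI: "s * t * s = s \<Longrightarrow> t * s * t = t \<Longrightarrow> star s = t" for s :: "'s::inverse_semigroup"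
  unfolding star_def using ex1_star[of s] by (intro the1_equality) auto

lemma star_props: "s * star s * s = s" "star s * s * star s = star s" for s :: "'s::inverse_semigroup"
  unfolding star_def using theI'[OF ex1_star[of s]] by auto

lemma idempotents_iff: "e \<in> idempotents \<longleftrightarrow> e * e = e"
  unfolding idempotents_def using star_eqI[of e e] by auto

lemma idempotents_mult:
  assumes "e \<in> idempotents" "f \<in> idempotents"
  shows "e * f \<in> idempotents"
proof -
  have e: "e * e = e" "e * (e * x) = e * x" and f: "f * f = f" "f * (f * x) = f * x" for x
    using assms by (simp_all add: idempotents_iff mult.assoc[symmetric])
  define x where "x = star (e * f)"
  have x: "e * (f * (x * (e * f))) = e * f" "x * (e * (f * x)) = x"
    using star_props[of "e * f"] by (simp_all add: x_def mult.assoc)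
  have x': "x * (e * (f * (x * y))) = x * y" for y
    using arg_cong[OF x(2), of "\<lambda>z. z * y"] by (simp add: mult.assoc)
  have "star (e * f) = f * x * e"
    by (rule star_eqI) (simp_all add: mult.assoc e f x x')
  then have "x = f * x * e" by (simp add: x_def)
  moreover have "(f * x * e) * (f * x * e) = f * x * e"
    by (simp add: mult.assoc x')
  ultimately have "x * x = x" by simp
  then have "star x = x" by (intro star_eqI) simp_all
  moreover have "star x = e * f"
    by (rule star_eqI) (simp_all add: mult.assoc x)
  ultimately show ?thesis using \<open>x * x = x\<close> by (simp add: idempotents_iff)
qed

definition group_cong :: "'s::inverse_semigroup \<Rightarrow> 's \<Rightarrow> bool" (infix "\<approx>" 50)
  where "s \<approx> t \<longleftrightarrow>
    \<delta> s - \<delta> t \<in> closure (cspan {\<delta> (u * e * v) - \<delta> (u * v) | u e v. e \<in> idempotents})"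

lemma subspace_closure:
  fixes V :: "'a::real_normed_vector set"
  assumes "subspace V"
  shows "subspace (closure V)"
  unfolding subspace_def
proof (intro conjI ballI allI)
  show "0 \<in> closure V"
    using subspace_0[OF assms] closure_subset by blast
  fix x assume "x \<in> closure V"
  then obtain X where X: "\<And>n. X n \<in> V" "X \<longlonglongrightarrow> x" unfolding closure_sequential by blast
  show "c *\<^sub>R x \<in> closure V" for c
    unfolding closure_sequential using X subspace_scale[OF assms]
    by (intro exI[of _ "\<lambda>n. c *\<^sub>R X n"]) (auto intro!: tendsto_intros)
  fix y assume "y \<in> closure V"
  then obtain Y where Y: "\<And>n. Y n \<in> V" "Y \<longlonglongrightarrow> y" unfolding closure_sequential by blast
  show "x + y \<in> closure V"
    unfolding closure_sequential using X Y subspace_add[OF assms]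
    by (intro exI[of _ "\<lambda>n. X n + Y n"]) (auto intro!: tendsto_intros)
qed

lemma equiv_group_cong: "equiv UNIV {(s, t). s \<approx> t}"
proof (rule equivI)
  let ?V = "cspan {\<delta> (u * e * v) - \<delta> (u * v) | u e v :: 'a. e \<in> idempotents}"
  have "subspace ?V"
    by (auto simp: subspace_def scaleR_scaleC intro: complex_vector.span_zero complex_vector.span_add
        complex_vector.span_scale)
  then have V: "subspace (closure ?V)" by (rule subspace_closure)
  show "refl {(s, t :: 'a). s \<approx> t}"
    using subspace_0[OF V] by (auto simp: refl_on_def group_cong_def)
  show "sym {(s, t :: 'a). s \<approx> t}"
    using subspace_neg[OF V] by (force simp: sym_def group_cong_def)
  show "trans {(s, t :: 'a). s \<approx> t}"
    using subspace_add[OF V] by (force simp: trans_def group_cong_def)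
qed simp

definition max_group_image :: "'s::inverse_semigroup set set"
  where "max_group_image = UNIV // {(s, t). s \<approx> t}"

text \<open>
  The actions of \<open>\<ell>\<^sup>1(E)\<close> on \<open>\<ell>\<^sup>1(S)\<close> extending \<open>\<delta>\<^sub>e \<cdot> \<delta>\<^sub>s = \<delta>\<^sub>s\<close> and \<open>\<delta>\<^sub>s \<cdot> \<delta>\<^sub>e = \<delta>\<^bsub>se\<^esub>\<close>.
  They are only used for first, respectively second, arguments in \<^term>\<open>ell1_on idempotents\<close>.
\<close>

definition ell1_lact :: "'s::inverse_semigroup ell1 \<Rightarrow> 's ell1 \<Rightarrow> 's ell1"
  where "ell1_lact = bilinear_ext (\<lambda>e s. s)"

definition ell1_ract :: "'s::inverse_semigroup ell1 \<Rightarrow> 's ell1 \<Rightarrow> 's ell1"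
  where "ell1_ract = bilinear_ext (\<lambda>s e. s * e)"

lemma ell1_lact_point_mass: "ell1_lact (\<delta> e) (\<delta> s) = \<delta> s"
  and ell1_ract_point_mass: "ell1_ract (\<delta> s) (\<delta> e) = \<delta> (s * e)"
  and point_mass_mult: "\<delta> s * \<delta> t = \<delta> (s * t)"
  by (simp_all add: ell1_lact_def ell1_ract_def times_ell1_def bilinear_ext_point_mass)

definition T0_scalars :: "'s::inverse_semigroup ell1 tri set"
  where "T0_scalars = {Tri \<alpha> 0 \<alpha> | \<alpha>. \<alpha> \<in> ell1_on idempotents}"

text \<open>Meant for \<open>A = Tri \<alpha> 0 \<alpha>\<close>, where both diagonal entries are \<open>\<alpha>\<close>.\<close>

definition T0_lact :: "'s::inverse_semigroup ell1 tri \<Rightarrow> 's ell1 tri \<Rightarrow> 's ell1 tri"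
  where "T0_lact A X =
    Tri (ell1_lact (tri11 A) (tri11 X)) (ell1_lact (tri11 A) (tri12 X)) (ell1_lact (tri11 A) (tri22 X))"

definition T0_ract :: "'s::inverse_semigroup ell1 tri \<Rightarrow> 's ell1 tri \<Rightarrow> 's ell1 tri"
  where "T0_ract X A =
    Tri (ell1_ract (tri11 X) (tri11 A)) (ell1_ract (tri12 X) (tri11 A)) (ell1_ract (tri22 X) (tri11 A))"

lemma bounded_linear_ell1_coeff: "bounded_linear (\<lambda>f. ell1_coeff f s)"
  by (rule bounded_linear_intro[where K = 1])
    (simp_all add: plus_ell1.rep_eq scaleR_scaleC scaleC_ell1.rep_eq scaleR_conv_of_real cmod_ell1_coeff_le)

lemma ell1_on_mult:
  assumes "f \<in> ell1_on A" "g \<in> ell1_on A" "\<And>s t. s \<in> A \<Longrightarrow> t \<in> A \<Longrightarrow> s * t \<in> A"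
  shows "f * g \<in> ell1_on A"
  unfolding ell1_on_def times_ell1_def
proof (intro CollectI allI impI)
  fix u assume "u \<notin> A"
  then have "ell1_coeff f s * ell1_coeff g t = 0" if "s * t = u" for s t
    using assms that by (auto simp: ell1_on_def)
  then show "ell1_coeff (bilinear_ext (*) f g) u = 0"
    by (auto simp: bilinear_ext.rep_eq intro!: infsum_0)
qed

lemma csubspace_ell1_on: "csubspace (ell1_on A)"
  by (simp add: complex_vector.subspace_def ell1_on_def plus_ell1.rep_eq zero_ell1.rep_eq scaleC_ell1.rep_eq)

lemma T0_scalars_iff:
  "A \<in> T0_scalars \<longleftrightarrow> tri12 A = 0 \<and> tri11 A = tri22 A \<and> tri11 A \<in> ell1_on idempotents"
  by (cases A) (auto simp: T0_scalars_def)

lemma banach_bimodule_T0: "banach_bimodule T0_scalars T0_lact T0_ract"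
proof
  fix \<alpha> \<beta> a b :: "'a ell1 tri" and c :: complex
  have "T0_scalars = {A :: 'a ell1 tri. tri12 A = 0} \<inter> {A. tri11 A = tri22 A} \<inter>
      (\<Inter>s\<in>- idempotents. {A. ell1_coeff (tri11 A) s = 0})"
    by (auto simp: T0_scalars_iff ell1_on_def)
  also have "closed \<dots>"
    by (intro closed_Int closed_INT ballI closed_Collect_eq continuous_on_const
        bounded_linear.continuous_on[OF _ continuous_on_id] bounded_linear_tri_entries
        bounded_linear_compose[OF bounded_linear_ell1_coeff bounded_linear_tri_entries(1)])
  finally show "closed (T0_scalars :: 'a ell1 tri set)" .
  show "csubspace (T0_scalars :: 'a ell1 tri set)"
    using csubspace_ell1_on[of "idempotents :: 'a set"]
    by (auto simp: complex_vector.subspace_def T0_scalars_iff plus_tri_def zero_tri_def scaleC_tri_def)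
  show "\<alpha> * \<beta> \<in> T0_scalars" if "\<alpha> \<in> T0_scalars" "\<beta> \<in> T0_scalars"
    using that by (auto simp: T0_scalars_iff times_tri_def intro!: ell1_on_mult idempotents_mult)
  show "T0_lact (\<alpha> + \<beta>) a = T0_lact \<alpha> a + T0_lact \<beta> a" "T0_lact \<alpha> (a + b) = T0_lact \<alpha> a + T0_lact \<alpha> b"
    "T0_lact (c *\<^sub>C \<alpha>) a = c *\<^sub>C T0_lact \<alpha> a" "T0_lact \<alpha> (c *\<^sub>C a) = c *\<^sub>C T0_lact \<alpha> a"
    "T0_ract a (\<alpha> + \<beta>) = T0_ract a \<alpha> + T0_ract a \<beta>" "T0_ract (a + b) \<alpha> = T0_ract a \<alpha> + T0_ract b \<alpha>"
    "T0_ract a (c *\<^sub>C \<alpha>) = c *\<^sub>C T0_ract a \<alpha>" "T0_ract (c *\<^sub>C a) \<alpha> = c *\<^sub>C T0_ract a \<alpha>"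
    by (simp_all add: T0_lact_def T0_ract_def ell1_lact_def ell1_ract_def plus_tri_def scaleC_tri_def
        bilinear_ext_add bilinear_ext_scaleC)
  have tri_bound: "norm (Tri x y z) \<le> 1 * norm \<alpha> * norm a"
    if "norm x \<le> norm (tri11 \<alpha>) * norm (tri11 a)" "norm y \<le> norm (tri11 \<alpha>) * norm (tri12 a)"
      "norm z \<le> norm (tri11 \<alpha>) * norm (tri22 a)" for \<alpha> a :: "'a ell1 tri" and x y z
  proof -
    have "norm (Tri x y z) \<le> norm (tri11 \<alpha>) * norm a"
      using that by (simp add: norm_tri_def distrib_left)
    also have "\<dots> \<le> norm \<alpha> * norm a"
      by (intro mult_right_mono) (simp_all add: norm_tri_def)
    finally show ?thesis by simp
  qed
  have l: "norm (T0_lact \<alpha> a) \<le> 1 * norm \<alpha> * norm a" for \<alpha> a :: "'a ell1 tri"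
    unfolding T0_lact_def ell1_lact_def by (intro tri_bound norm_bilinear_ext)
  have r: "norm (T0_ract a \<alpha>) \<le> 1 * norm \<alpha> * norm a" for \<alpha> a :: "'a ell1 tri"
    unfolding T0_ract_def ell1_ract_def
    by (intro tri_bound order_trans[OF norm_bilinear_ext]) (simp_all add: mult.commute)
  show "\<exists>K. \<forall>\<alpha>\<in>T0_scalars. \<forall>a :: 'a ell1 tri. norm (T0_lact \<alpha> a) \<le> K * norm \<alpha> * norm a"
    using l by blast
  show "\<exists>K. \<forall>\<alpha>\<in>T0_scalars. \<forall>a :: 'a ell1 tri. norm (T0_ract a \<alpha>) \<le> K * norm \<alpha> * norm a"
    using r by blast
  show "T0_lact (\<alpha> * \<beta>) a = T0_lact \<alpha> (T0_lact \<beta> a)"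
    by (simp add: T0_lact_def ell1_lact_def times_tri_def times_ell1_def bilinear_ext_assoc)
  show "T0_ract a (\<alpha> * \<beta>) = T0_ract (T0_ract a \<alpha>) \<beta>"
    by (simp add: T0_ract_def ell1_ract_def times_tri_def times_ell1_def bilinear_ext_assoc mult.assoc)
  show "T0_ract (T0_lact \<alpha> a) \<beta> = T0_lact \<alpha> (T0_ract a \<beta>)"
    by (simp add: T0_lact_def T0_ract_def ell1_lact_def ell1_ract_def bilinear_ext_assoc)
  show "T0_lact \<alpha> (a * b) = T0_lact \<alpha> a * b"
    by (simp add: T0_lact_def ell1_lact_def times_tri_def times_ell1_def bilinear_ext_add bilinear_ext_assoc)
  show "T0_ract (a * b) \<alpha> = a * T0_ract b \<alpha>"
    by (simp add: T0_ract_def ell1_ract_def times_tri_def times_ell1_def bilinear_ext_add bilinear_ext_assoc mult.assoc)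
qed

end

(*
  Module Arens regularity says that the two Arens products agree on every functional f that
  annihilates the module ideal J.  Congruent elements of S have equal images modulo J in each
  matrix entry.  So if G_S is finite, then (a, b) \<mapsto> f(ab) is a finite sum of products of
  functionals, and the two iterated limits agree.  If G_S is infinite, choose sequences s_n, t_m
  such that no s_n t_m with n < m is congruent to an s_p t_q with q \<le> p, and let f be the
  functional on the (1,1) entry given by the indicator function of the classes of the former.
  Along weak-star cluster points of the two sequences, the iterated limits of f are 1 and 0.
*)
theory Submission
  imports Defs "HOL-Analysis.Function_Topology" "HOL-Analysis.Topology_Euclidean_Space"
begin

no_notation eqpoll (infixl "\<approx>" 50)

section \<open>Functionals on \<open>\<ell>\<^sup>1\<close>\<close>

lemma cdual_exists:
  assumes "bounded_linear f" "\<And>c x. f (c *\<^sub>C x) = c * f x"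
  shows "\<exists>g. \<forall>x. \<langle>g, x\<rangle> = f x"
  using assms by (intro exI[of _ "Abs_cdual f"]) (simp add: Abs_cdual_inverse)

lemma dual_apply_sum: "\<langle>f, \<Sum>i\<in>I. x i\<rangle> = (\<Sum>i\<in>I. \<langle>f, x i\<rangle>)"
  by (induction I rule: infinite_finite_induct) (auto simp: dual_apply_add dual_apply_zero)

lemma sum_cdual_apply: "\<langle>\<Sum>i\<in>I. f i, x\<rangle> = (\<Sum>i\<in>I. \<langle>f i, x\<rangle>)"
  by (induction I rule: infinite_finite_induct) (auto simp: plus_cdual.rep_eq zero_cdual.rep_eq)

lemma ell1_coeff_sum: "ell1_coeff (\<Sum>i\<in>I. x i) s = (\<Sum>i\<in>I. ell1_coeff (x i) s)"
  by (induction I rule: infinite_finite_induct) (auto simp: plus_ell1.rep_eq zero_ell1.rep_eq)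

lemma norm_point_mass: "norm (\<delta> s) = 1"
proof -
  have "norm (\<delta> s) = (\<Sum>\<^sub>\<infinity>t\<in>{s}. 1)"
    unfolding norm_ell1.rep_eq by (rule infsum_cong_neutral) (auto simp: point_mass.rep_eq)
  then show ?thesis by simp
qed

text \<open>The absolute values of the coefficients sum to \<open>norm x\<close> unconditionally, so
  some finite partial sum comes within \<epsilon>. The norm of the remainder is exactly the missing
  tail.\<close>

lemma ell1_finite_approx:
  fixes x :: "'a ell1"
  assumes "0 < \<epsilon>"
  obtains F where "finite F" "norm (x - (\<Sum>s\<in>F. ell1_coeff x s *\<^sub>C \<delta> s)) < \<epsilon>"
proof -
  have "((\<lambda>s. cmod (ell1_coeff x s)) has_sum norm x) UNIV"
    unfolding norm_ell1.rep_eq by (intro has_sum_infsum abs_summable_ell1_coeff)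
  then have "\<forall>\<^sub>F F in finite_subsets_at_top UNIV. dist (\<Sum>s\<in>F. cmod (ell1_coeff x s)) (norm x) < \<epsilon>"
    unfolding has_sum_def using assms by (rule tendstoD)
  then obtain F where F: "finite F" "dist (\<Sum>s\<in>F. cmod (ell1_coeff x s)) (norm x) < \<epsilon>"
    unfolding eventually_finite_subsets_at_top by auto
  let ?y = "x - (\<Sum>s\<in>F. ell1_coeff x s *\<^sub>C \<delta> s)"
  have coeff: "ell1_coeff ?y t = (if t \<in> F then 0 else ell1_coeff x t)" for t
    using F(1) by (simp add: minus_ell1.rep_eq ell1_coeff_sum scaleC_ell1.rep_eq point_mass.rep_eq
        if_distrib[of "\<lambda>z. _ * z"] cong: if_cong)
  have "norm ?y = (\<Sum>\<^sub>\<infinity>t\<in>UNIV - F. cmod (ell1_coeff x t))"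
    unfolding norm_ell1.rep_eq by (rule infsum_cong_neutral) (auto simp: coeff)
  also have "\<dots> = norm x - (\<Sum>s\<in>F. cmod (ell1_coeff x s))"
    using F(1) by (subst infsum_Diff) (auto simp: norm_ell1.rep_eq abs_summable_ell1_coeff)
  also have "\<dots> < \<epsilon>"
    using F(2) by (simp add: dist_real_def)
  finally show thesis using F(1) that by blast
qed

text \<open>Finite combinations of point masses are dense and functionals are continuous.\<close>

lemma cdual_ell1_eqI:
  fixes f g :: "'a ell1 cdual"
  assumes "\<And>s. \<langle>f, \<delta> s\<rangle> = \<langle>g, \<delta> s\<rangle>"
  shows "f = g"
proof (rule cdual_eqI)
  fix x
  let ?h = "f - g"
  have h: "\<langle>?h, \<delta> s\<rangle> = 0" for s
    using assms by (simp add: minus_cdual.rep_eq)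
  have "cmod \<langle>?h, x\<rangle> \<le> norm ?h * \<epsilon>" if \<epsilon>: "0 < \<epsilon>" for \<epsilon>
  proof -
    obtain F where "finite F" and F: "norm (x - (\<Sum>s\<in>F. ell1_coeff x s *\<^sub>C \<delta> s)) < \<epsilon>"
      using ell1_finite_approx[OF \<epsilon>] by blast
    have "\<langle>?h, x\<rangle> = \<langle>?h, x - (\<Sum>s\<in>F. ell1_coeff x s *\<^sub>C \<delta> s)\<rangle>"
      by (simp add: dual_apply_diff dual_apply_sum dual_apply_scaleC h)
    also have "cmod \<dots> \<le> norm ?h * norm (x - (\<Sum>s\<in>F. ell1_coeff x s *\<^sub>C \<delta> s))"
      by (rule norm_dual_apply)
    also have "\<dots> \<le> norm ?h * \<epsilon>"
      using F by (intro mult_left_mono) auto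
    finally show ?thesis .
  qed
  note le = this
  have "cmod \<langle>?h, x\<rangle> \<le> 0 + e" if "e > 0" for e :: real
  proof -
    \<comment> \<open>Adding 1 keeps the denominator positive even when \<open>norm ?h\<close> is
      0.\<close>
    have "cmod \<langle>?h, x\<rangle> \<le> norm ?h * (e / (norm ?h + 1))"
      using that by (intro le) (auto intro!: divide_pos_pos add_nonneg_pos)
    also have "\<dots> \<le> e"
      using that by (simp add: pos_divide_le_eq add_nonneg_pos distrib_left)
    finally show ?thesis by simp
  qed
  then have "cmod \<langle>?h, x\<rangle> \<le> 0" by (rule field_le_epsilon)
  then show "\<langle>f, x\<rangle> = \<langle>g, x\<rangle>" by (simp add: minus_cdual.rep_eq)
qed

lemma ell1_pairing:
  assumes k: "\<And>u. cmod (k u) \<le> K"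
  shows "(\<lambda>u. ell1_coeff x u * k u) summable_on UNIV"
    and "cmod (\<Sum>\<^sub>\<infinity>u. ell1_coeff x u * k u) \<le> norm x * K"
proof -
  have le: "cmod (ell1_coeff x u * k u) \<le> cmod (ell1_coeff x u) * K" for u
    unfolding norm_mult by (intro mult_left_mono k) auto
  have sK: "(\<lambda>u. cmod (ell1_coeff x u) * K) summable_on UNIV"
    by (intro summable_on_cmult_left abs_summable_ell1_coeff)
  have abs: "(\<lambda>u. ell1_coeff x u * k u) abs_summable_on UNIV"
    by (rule abs_summable_on_comparison_test'[OF sK le])
  then show "(\<lambda>u. ell1_coeff x u * k u) summable_on UNIV"
    by (rule abs_summable_summable)
  have "cmod (\<Sum>\<^sub>\<infinity>u. ell1_coeff x u * k u) \<le> (\<Sum>\<^sub>\<infinity>u. cmod (ell1_coeff x u * k u))"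
    by (rule norm_infsum_bound[OF abs])
  also have "\<dots> \<le> (\<Sum>\<^sub>\<infinity>u. cmod (ell1_coeff x u) * K)"
    by (intro infsum_mono abs sK le)
  also have "\<dots> = norm x * K"
    by (simp add: infsum_cmult_left' norm_ell1.rep_eq)
  finally show "cmod (\<Sum>\<^sub>\<infinity>u. ell1_coeff x u * k u) \<le> norm x * K" .
qed

text \<open>One direction of the duality between ell^1 and the bounded functions. The bound on
  \<open>k\<close> makes the pairing converge and bounds the functional.\<close>

lemma bounded_function_cdual:
  fixes k :: "'a \<Rightarrow> complex"
  assumes k: "\<And>u. cmod (k u) \<le> K"
  shows "\<exists>f. \<forall>x. \<langle>f, x\<rangle> = (\<Sum>\<^sub>\<infinity>u. ell1_coeff x u * k u)"
proof (rule cdual_exists)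
  show C: "(\<Sum>\<^sub>\<infinity>u. ell1_coeff (c *\<^sub>C x) u * k u) = c * (\<Sum>\<^sub>\<infinity>u. ell1_coeff x u * k u)" for c x
    by (simp add: scaleC_ell1.rep_eq mult.assoc infsum_cmult_right')
  show "bounded_linear (\<lambda>x. \<Sum>\<^sub>\<infinity>u. ell1_coeff x u * k u)"
    by (rule bounded_linear_intro[where K = K])
      (simp_all add: plus_ell1.rep_eq distrib_right infsum_add[OF ell1_pairing(1) ell1_pairing(1), OF k k]
        ell1_pairing(2) k C scaleR_scaleC scaleR_conv_of_real)
qed

text \<open>This is the adjoint of \<open>T\<close> applied to \<open>f\<close>; it moves
  functionals between ell^1 and the matrix algebra.\<close>

lemma cdual_compose:
  assumes "bounded_linear T" "\<And>c x. T (c *\<^sub>C x) = c *\<^sub>C T x"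
  shows "\<exists>g. \<forall>x. \<langle>g, x\<rangle> = \<langle>f, T x\<rangle>"
  by (rule cdual_exists)
    (simp_all add: assms dual_apply_scaleC bounded_linear_compose[OF bounded_linear_dual_apply assms(1)])


section \<open>Arens products on a single functional\<close>

text \<open>All translates of \<open>f\<close> from one side are combinations of the \<psi> i, and
  from the other side of the \<phi> i. Hence both Arens products take \<open>f\<close> to the sum of
  \<open>\<langle>\<Gamma>\<^sub>1, \<phi> i\<rangle> * \<langle>\<Gamma>\<^sub>2, \<psi>
  i\<rangle>\<close>.\<close>

lemma arens_eq_if_finite_rank:
  fixes f :: "'a::complex_normed_algebra cdual"
  assumes "\<And>a b. \<langle>f, a * b\<rangle> = (\<Sum>i\<in>I. \<langle>\<phi> i, a\<rangle> * \<langle>\<psi> i, b\<rangle>)"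
  shows "\<langle>\<Gamma>\<^sub>1 \<box> \<Gamma>\<^sub>2, f\<rangle> = \<langle>\<Gamma>\<^sub>1 \<diamond> \<Gamma>\<^sub>2, f\<rangle>"
proof -
  have "dual_right f a = (\<Sum>i\<in>I. \<langle>\<phi> i, a\<rangle> *\<^sub>C \<psi> i)" for a
    by (rule cdual_eqI) (simp add: dual_right.rep_eq assms sum_cdual_apply scaleC_cdual.rep_eq)
  then have l: "bidual_left \<Gamma>\<^sub>2 f = (\<Sum>i\<in>I. \<langle>\<Gamma>\<^sub>2, \<psi> i\<rangle> *\<^sub>C \<phi> i)"
    by (intro cdual_eqI) (simp add: bidual_left.rep_eq sum_cdual_apply scaleC_cdual.rep_eq
        dual_apply_sum dual_apply_scaleC mult.commute)
  have "dual_left b f = (\<Sum>i\<in>I. \<langle>\<psi> i, b\<rangle> *\<^sub>C \<phi> i)" for b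
    by (rule cdual_eqI) (simp add: dual_left.rep_eq assms sum_cdual_apply scaleC_cdual.rep_eq mult.commute)
  then have r: "bidual_right f \<Gamma>\<^sub>1 = (\<Sum>i\<in>I. \<langle>\<Gamma>\<^sub>1, \<phi> i\<rangle> *\<^sub>C \<psi> i)"
    by (intro cdual_eqI) (simp add: bidual_right.rep_eq sum_cdual_apply scaleC_cdual.rep_eq
        dual_apply_sum dual_apply_scaleC mult.commute)
  show ?thesis
    by (simp add: arens1_apply arens2_apply l r dual_apply_sum dual_apply_scaleC mult.commute)
qed

text \<open>This is the Banach-Alaoglu argument. The evaluations at the \<open>a n\<close> lie in a
  product of closed discs, which is compact by Tychonoff, so they cluster. A filter finer than
  \<open>sequentially\<close> replaces a subsequence, since the weak-star topology need not be
  metrizable.\<close>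

lemma bounded_sequence_weak_star_cluster:
  fixes a :: "nat \<Rightarrow> 'a::complex_normed_vector"
  assumes a: "\<And>n. norm (a n) \<le> C"
  obtains \<Gamma> F where "F \<noteq> bot" "F \<le> sequentially" "weak_star_lim (\<lambda>n. bidual_embed (a n)) \<Gamma> F"
proof -
  define \<psi> :: "nat \<Rightarrow> 'a cdual \<Rightarrow> complex" where "\<psi> n f = \<langle>f, a n\<rangle>" for n f
  let ?K = "PiE UNIV (\<lambda>f :: 'a cdual. cball (0::complex) (norm f * C))"
  have "compactin (product_topology (\<lambda>_. euclidean) UNIV) ?K"
    unfolding compactin_PiE by auto
  then have "compact ?K"
    by (simp add: euclidean_product_topology)
  moreover have "\<psi> n \<in> ?K" for n
  proof -
    have "cmod \<langle>f, a n\<rangle> \<le> norm f * C" for f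
      by (rule order_trans[OF norm_dual_apply]) (intro mult_left_mono a norm_ge_zero)
    then show ?thesis by (auto simp: \<psi>_def dist_norm PiE_iff)
  qed
  then have "\<forall>\<^sub>F x in filtermap \<psi> sequentially. x \<in> ?K"
    by (simp add: eventually_filtermap)
  moreover have "filtermap \<psi> sequentially \<noteq> bot"
    by (simp add: filtermap_bot_iff)
  ultimately obtain \<Gamma>0 where \<Gamma>0: "\<Gamma>0 \<in> ?K" "inf (nhds \<Gamma>0) (filtermap \<psi> sequentially) \<noteq> bot"
    unfolding compact_filter by blast
  \<comment> \<open>\<open>F\<close> couples n tending to infinity with \<open>\<psi> n\<close>
    tending to \<open>\<Gamma>0\<close>. It is proper precisely because \<open>\<Gamma>0\<close> is
    a cluster point.\<close>
  define F where "F = inf sequentially (filtercomap \<psi> (nhds \<Gamma>0))"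
  have "F \<noteq> bot"
  proof
    assume "F = bot"
    then have "eventually (\<lambda>_. False) F" by simp
    then obtain P Q where P: "eventually P sequentially" and Q: "eventually Q (nhds \<Gamma>0)"
      and PQ: "\<And>n. P n \<Longrightarrow> Q (\<psi> n) \<Longrightarrow> False"
      unfolding F_def eventually_inf eventually_filtercomap by blast
    have "eventually (\<lambda>x. \<not> Q x) (filtermap \<psi> sequentially)"
      unfolding eventually_filtermap using P by (rule eventually_mono) (use PQ in blast)
    with Q have "eventually (\<lambda>_. False) (inf (nhds \<Gamma>0) (filtermap \<psi> sequentially))"
      unfolding eventually_inf by blast
    then show False using \<Gamma>0(2) by (simp add: eventually_False)
  qed
  have "filterlim \<psi> (nhds \<Gamma>0) F"
    by (simp add: F_def filterlim_def filtermap_le_iff_le_filtercomap)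
  then have lim: "((\<lambda>n. \<langle>f, a n\<rangle>) \<longlongrightarrow> \<Gamma>0 f) F" for f
    using continuous_on_tendsto_compose[OF continuous_on_product_coordinates[of f], of \<psi> \<Gamma>0 F]
    by (simp add: \<psi>_def)
  \<comment> \<open>Linearity passes to \<open>\<Gamma>0\<close> by uniqueness of limits along
    \<open>F\<close>; the norm bound comes from membership in \<open>?K\<close>.\<close>
  have C: "\<Gamma>0 (c *\<^sub>C f) = c * \<Gamma>0 f" for c f
    using \<open>F \<noteq> bot\<close> lim[of "c *\<^sub>C f"] tendsto_mult_left[OF lim[of f], of c]
    by (auto simp: scaleC_cdual.rep_eq intro: tendsto_unique)
  have "bounded_linear \<Gamma>0"
  proof (rule bounded_linear_intro[where K = C])
    show "\<Gamma>0 (f + g) = \<Gamma>0 f + \<Gamma>0 g" for f g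
      using \<open>F \<noteq> bot\<close> lim[of "f + g"] tendsto_add[OF lim[of f] lim[of g]]
      by (auto simp: plus_cdual.rep_eq intro: tendsto_unique)
    show "\<Gamma>0 (r *\<^sub>R f) = r *\<^sub>R \<Gamma>0 f" for r f
      by (simp add: scaleR_scaleC C scaleR_conv_of_real)
    show "cmod (\<Gamma>0 f) \<le> norm f * C" for f
      using \<Gamma>0(1) by auto
  qed
  then obtain \<Gamma> where \<Gamma>: "\<And>f. \<langle>\<Gamma>, f\<rangle> = \<Gamma>0 f"
    using cdual_exists C by blast
  show thesis
  proof (rule that[OF \<open>F \<noteq> bot\<close>])
    show "F \<le> sequentially" by (simp add: F_def)
    show "weak_star_lim (\<lambda>n. bidual_embed (a n)) \<Gamma> F"
      by (simp add: weak_star_lim_def bidual_embed.rep_eq \<Gamma> lim)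
  qed
qed

text \<open>The easy half of Grothendieck's double limit criterion.\<close>

lemma arens_products_differ:
  fixes f :: "'a::complex_normed_algebra cdual" and a b :: "nat \<Rightarrow> 'a"
  assumes "\<And>n. norm (a n) \<le> C" "\<And>n. norm (b n) \<le> D"
    and one: "\<And>n m. n < m \<Longrightarrow> \<langle>f, a n * b m\<rangle> = 1" and zero: "\<And>n m. m \<le> n \<Longrightarrow> \<langle>f, a n * b m\<rangle> = 0"
  shows "\<exists>\<Gamma>\<^sub>1 \<Gamma>\<^sub>2. \<langle>\<Gamma>\<^sub>1 \<box> \<Gamma>\<^sub>2, f\<rangle> \<noteq> \<langle>\<Gamma>\<^sub>1 \<diamond> \<Gamma>\<^sub>2, f\<rangle>"
proof -
  obtain \<Gamma>\<^sub>1 F where F: "F \<noteq> bot" "F \<le> sequentially" "weak_star_lim (\<lambda>n. bidual_embed (a n)) \<Gamma>\<^sub>1 F"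
    using bounded_sequence_weak_star_cluster assms(1) by blast
  obtain \<Gamma>\<^sub>2 G where G: "G \<noteq> bot" "G \<le> sequentially" "weak_star_lim (\<lambda>n. bidual_embed (b n)) \<Gamma>\<^sub>2 G"
    using bounded_sequence_weak_star_cluster assms(2) by blast
  have lF: "((\<lambda>n. \<langle>g, a n\<rangle>) \<longlongrightarrow> \<langle>\<Gamma>\<^sub>1, g\<rangle>) F" and lG: "((\<lambda>n. \<langle>g, b n\<rangle>) \<longlongrightarrow> \<langle>\<Gamma>\<^sub>2, g\<rangle>) G" for g
    using F(3) G(3) by (simp_all add: weak_star_lim_def bidual_embed.rep_eq)
  \<comment> \<open>For fixed n, eventually n < m along \<open>G\<close>. So
    \<open>bidual_left \<Gamma>\<^sub>2 f\<close> is 1 at every \<open>a n\<close>, and the outer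
    limit along \<open>F\<close> is 1 too.\<close>
  have "\<langle>\<Gamma>\<^sub>2, dual_right f (a n)\<rangle> = 1" for n
  proof (rule tendsto_unique[OF G(1) lG])
    have "\<forall>\<^sub>F m in G. n < m"
      using G(2) eventually_gt_at_top[of n] by (auto simp: le_filter_def)
    then show "((\<lambda>m. \<langle>dual_right f (a n), b m\<rangle>) \<longlongrightarrow> 1) G"
      by (intro tendsto_eventually) (auto elim!: eventually_mono simp: dual_right.rep_eq one)
  qed
  then have "\<langle>\<Gamma>\<^sub>1, bidual_left \<Gamma>\<^sub>2 f\<rangle> = 1"
    using tendsto_unique[OF F(1) lF[of "bidual_left \<Gamma>\<^sub>2 f"], of 1] by (simp add: bidual_left.rep_eq)
  \<comment> \<open>With the limits in the other order, m is fixed and eventually m \<le> n along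
    \<open>F\<close>.\<close>
  moreover have "\<langle>\<Gamma>\<^sub>1, dual_left (b m) f\<rangle> = 0" for m
  proof (rule tendsto_unique[OF F(1) lF])
    have "\<forall>\<^sub>F n in F. m \<le> n"
      using F(2) eventually_ge_at_top[of m] by (auto simp: le_filter_def)
    then show "((\<lambda>n. \<langle>dual_left (b m) f, a n\<rangle>) \<longlongrightarrow> 0) F"
      by (intro tendsto_eventually) (auto elim!: eventually_mono simp: dual_left.rep_eq zero)
  qed
  then have "\<langle>\<Gamma>\<^sub>2, bidual_right f \<Gamma>\<^sub>1\<rangle> = 0"
    using tendsto_unique[OF G(1) lG[of "bidual_right f \<Gamma>\<^sub>1"], of 0] by (simp add: bidual_right.rep_eq)
  ultimately show ?thesis
    by (metis arens1_apply arens2_apply zero_neq_one)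
qed

text \<open>A double annihilator is tested against the functionals vanishing on the ideal, so
  regularity can be checked one functional at a time.\<close>

lemma module_arens_regular_iff:
  "module_arens_regular \<AA> lact ract \<longleftrightarrow>
    (\<forall>f\<in>annihilator (module_ideal \<AA> lact ract). \<forall>\<Gamma>\<^sub>1 \<Gamma>\<^sub>2. \<langle>\<Gamma>\<^sub>1 \<box> \<Gamma>\<^sub>2, f\<rangle> = \<langle>\<Gamma>\<^sub>1 \<diamond> \<Gamma>\<^sub>2, f\<rangle>)"
  unfolding module_arens_regular_def annihilator_def[of "annihilator _"]
  by (auto simp: minus_cdual.rep_eq)


section \<open>The congruence \<open>\<approx>\<close>\<close>

text \<open>Both \<open>e * f\<close> and \<open>f * e\<close> are inverses of \<open>e * f\<close>,
  and inverses are unique.\<close>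

lemma idempotents_commute: "e \<in> idempotents \<Longrightarrow> f \<in> idempotents \<Longrightarrow> e * f = f * e"
  for e f :: "'s::inverse_semigroup"
proof -
  assume ef: "e \<in> idempotents" "f \<in> idempotents"
  then have e: "e * e = e" "e * (e * x) = e * x" and f: "f * f = f" "f * (f * x) = f * x" for x
    by (simp_all add: idempotents_iff mult.assoc[symmetric])
  have "e * f * (e * f) = e * f" "f * e * (f * e) = f * e"
    using idempotents_mult[OF ef] idempotents_mult[OF ef(2,1)] by (simp_all add: idempotents_iff)
  then have "star (e * f) = e * f" "star (e * f) = f * e"
    by (auto intro!: star_eqI simp: mult.assoc e f)
  then show ?thesis by simp
qed

lemma star_mult_idempotent: "s * star s \<in> idempotents" "star s * s \<in> idempotents"
  using star_props[of s] by (simp_all add: idempotents_iff mult.assoc[symmetric])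

text \<open>The preimage of \<open>J\<close> under \<open>T\<close> is a closed subspace containing
  \<open>X\<close>. This reduces statements about the closed span defining \<approx> to its
  generators.\<close>

lemma closure_cspan_minimal:
  fixes J :: "'b::complex_normed_vector set"
  assumes "bounded_linear T" "\<And>c x. T (c *\<^sub>C x) = c *\<^sub>C T x" "closed J" "csubspace J"
    and "\<And>x. x \<in> X \<Longrightarrow> T x \<in> J" and "x \<in> closure (cspan X)"
  shows "T x \<in> J"
proof -
  interpret T: bounded_linear T by fact
  have "csubspace (T -` J)"
    using assms(4) by (simp add: complex_vector.subspace_def T.add T.zero assms(2))
  then have "cspan X \<subseteq> T -` J"
    using assms(5) by (intro complex_vector.span_minimal) auto
  moreover have "closed (T -` J)"
    using assms(3) by (intro continuous_closed_vimage) (auto intro: T.continuous)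
  ultimately show ?thesis
    using closure_minimal assms(6) by blast
qed

lemma
  fixes s t u :: "'a::inverse_semigroup"
  shows group_cong_refl: "s \<approx> s"
    and group_cong_sym: "s \<approx> t \<Longrightarrow> t \<approx> s"
    and group_cong_trans [trans]: "s \<approx> t \<Longrightarrow> t \<approx> u \<Longrightarrow> s \<approx> u"
  using equiv_group_cong[where 'a = 'a]
  unfolding equiv_def refl_on_def sym_def trans_def mem_Collect_eq case_prod_conv by blast+

lemma group_cong_idempotent: "e \<in> idempotents \<Longrightarrow> u * e * v \<approx> u * v"
  unfolding group_cong_def
  by (rule subsetD[OF closure_subset]) (auto intro!: complex_vector.span_base)

text \<open>The generators have an idempotent between two factors, and S may lack an identity to
  serve as the left one. Writing t as \<open>t * star t * t\<close> and commuting e past the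
  idempotent \<open>t * star t\<close> puts e in the middle.\<close>

lemma group_cong_idempotent_left: "e \<in> idempotents \<Longrightarrow> e * t \<approx> t"
proof -
  assume e: "e \<in> idempotents"
  have "e * t = e * (t * star t) * t"
    using star_props(1)[of t] by (simp add: mult.assoc)
  also have "\<dots> = (t * star t) * e * t"
    using idempotents_commute[OF e star_mult_idempotent(1)[of t]] by simp
  finally show ?thesis
    using group_cong_idempotent[OF e, of "t * star t" t] star_props(1)[of t] by simp
qed

lemma group_cong_idempotent_right: "e \<in> idempotents \<Longrightarrow> t * e \<approx> t"
proof -
  assume e: "e \<in> idempotents"
  have "t * e = t * (star t * t * e)"
    using star_props(1)[of t] by (simp add: mult.assoc[symmetric])
  also have "\<dots> = t * e * (star t * t)"
    using idempotents_commute[OF e star_mult_idempotent(2)[of t]] by (simp add: mult.assoc)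
  finally show ?thesis
    using group_cong_idempotent[OF e, of t "star t * t"] star_props(1)[of t] by (simp add: mult.assoc)
qed

lemma csubspace_closure:
  fixes V :: "'a::complex_normed_vector set"
  assumes V: "csubspace V"
  shows "csubspace (closure V)"
proof -
  have "subspace V"
    using V by (auto simp: complex_vector.subspace_def subspace_def scaleR_scaleC)
  then have sub: "subspace (closure V)" by (rule subspace_closure)
  have "c *\<^sub>C x \<in> closure V" if "x \<in> closure V" for c x
  proof -
    have "bounded_linear (\<lambda>x :: 'a. c *\<^sub>C x)"
      by (rule bounded_linear_intro[where K = "cmod c"])
        (simp_all add: scaleC_add_right scaleR_scaleC scaleC_scaleC mult.commute norm_scaleC)
    then have "(\<lambda>x. c *\<^sub>C x) ` closure V \<subseteq> closure ((\<lambda>x. c *\<^sub>C x) ` V)"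
      by (intro image_closure_subset closed_closure closure_subset linear_continuous_on)
    also have "\<dots> \<subseteq> closure V"
      using V by (intro closure_mono) (auto intro: complex_vector.subspace_scale)
    finally show ?thesis using that by blast
  qed
  with sub show ?thesis
    by (auto simp: complex_vector.subspace_def subspace_def)
qed

text \<open>Multiplication by \<open>\<delta> u\<close> is bounded and linear and maps generators of
  the closed span to generators.\<close>

lemma
  fixes s t u :: "'s::inverse_semigroup"
  assumes "s \<approx> t"
  shows group_cong_mult_left: "u * s \<approx> u * t" and group_cong_mult_right: "s * u \<approx> t * u"
proof -
  let ?X = "{\<delta> (u * e * v) - \<delta> (u * v) | u e v :: 's. e \<in> idempotents}"
  have J: "closed (closure (cspan ?X))" "csubspace (closure (cspan ?X))"
    by (auto intro: csubspace_closure complex_vector.subspace_span)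
  have X: "\<delta> (a * e * b) - \<delta> (a * b) \<in> closure (cspan ?X)" if "e \<in> idempotents" for a e b :: 's
    using group_cong_idempotent[OF that] unfolding group_cong_def .
  have "\<delta> u * (\<delta> s - \<delta> t) \<in> closure (cspan ?X)"
  proof (rule closure_cspan_minimal[OF bounded_linear_mult_right mult_scaleC_right J])
    show "\<delta> s - \<delta> t \<in> closure (cspan ?X)"
      using assms by (simp add: group_cong_def)
    fix x assume "x \<in> ?X"
    then obtain a e b where "x = \<delta> (a * e * b) - \<delta> (a * b)" "e \<in> idempotents" by blast
    then show "\<delta> u * x \<in> closure (cspan ?X)"
      using X[of e "u * a" b] by (simp add: right_diff_distrib point_mass_mult mult.assoc)
  qed
  then show "u * s \<approx> u * t"
    by (simp add: group_cong_def right_diff_distrib point_mass_mult)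
  have "(\<delta> s - \<delta> t) * \<delta> u \<in> closure (cspan ?X)"
  proof (rule closure_cspan_minimal[OF bounded_linear_mult_left mult_scaleC_left J])
    show "\<delta> s - \<delta> t \<in> closure (cspan ?X)"
      using assms by (simp add: group_cong_def)
    fix x assume "x \<in> ?X"
    then obtain a e b where "x = \<delta> (a * e * b) - \<delta> (a * b)" "e \<in> idempotents" by blast
    then show "x * \<delta> u \<in> closure (cspan ?X)"
      using X[of e a "b * u"] by (simp add: left_diff_distrib point_mass_mult mult.assoc)
  qed
  then show "s * u \<approx> t * u"
    by (simp add: group_cong_def left_diff_distrib point_mass_mult)
qed

text \<open>Since \<open>star u * u\<close> is idempotent, \<open>star u\<close> acts as an inverse
  of u modulo \<approx>. A coincidence of products can thus be solved for one factor.\<close>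

lemma group_cong_cancel_left: "u * s \<approx> v \<Longrightarrow> s \<approx> star u * v"
  by (metis group_cong_idempotent_left group_cong_mult_left group_cong_sym group_cong_trans
      mult.assoc star_mult_idempotent(2))

lemma group_cong_cancel_right: "s * u \<approx> v \<Longrightarrow> s \<approx> v * star u"
  by (metis group_cong_idempotent_right group_cong_mult_right group_cong_sym group_cong_trans
      mult.assoc star_mult_idempotent(1))

text \<open>Otherwise the classes of the elements of \<open>F\<close> would exhaust
  \<open>max_group_image\<close>.\<close>

lemma exists_group_cong_avoiding:
  assumes "infinite (max_group_image :: 's::inverse_semigroup set set)" "finite (F :: 's set)"
  shows "\<exists>s. \<forall>x\<in>F. \<not> s \<approx> x"
proof (rule ccontr)
  assume "\<not> ?thesis"
  then have F: "\<exists>x\<in>F. s \<approx> x" for s by blast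
  have "max_group_image \<subseteq> (\<lambda>x. {(s, t). s \<approx> t} `` {x}) ` F"
  proof
    fix C :: "'s set" assume "C \<in> max_group_image"
    then obtain s where s: "C = {(s, t). s \<approx> t} `` {s}"
      unfolding max_group_image_def by (rule quotientE)
    obtain x where x: "x \<in> F" "s \<approx> x" using F by blast
    have "C = {(s, t). s \<approx> t} `` {x}"
      unfolding s by (rule equiv_class_eq[OF equiv_group_cong]) (simp add: x)
    with x show "C \<in> (\<lambda>x. {(s, t). s \<approx> t} `` {x}) ` F" by blast
  qed
  then show False
    using assms finite_surj by blast
qed

text \<open>
  The two sequences are chosen alternately, \<open>t\<^sub>n\<close> before \<open>s\<^sub>n\<close>, so that in a coincidence of products
  the entry with the largest index would be determined by entries chosen before it.
\<close>

lemma separated_product_sequences: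
  assumes inf: "infinite (max_group_image :: 's::inverse_semigroup set set)"
  obtains s t :: "nat \<Rightarrow> 's::inverse_semigroup" where "\<And>n m p q. n < m \<Longrightarrow> q \<le> p \<Longrightarrow> \<not> s n * t m \<approx> s p * t q"
proof -
  \<comment> \<open>With \<open>f i\<close> read as the pair of s_i and t_i, \<open>T\<close> lists
    the solutions for t_n of s_i t_n \<approx> s_j t_m with i, j, m < n.\<close>
  define T where "T f n = (\<lambda>(i, j, m). star (fst (f i)) * (fst (f j) * snd (f m))) `
      ({..<n} \<times> {..<n} \<times> {..<n})" for f :: "nat \<Rightarrow> 's \<times> 's" and n
  \<comment> \<open>\<open>T'\<close> lists the solutions for s_n of s_n t_m \<approx> s_i t_j with
    i < n and j, m \<le> n. The index n is allowed for t because t_n is already chosen; its value is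
    \<open>z\<close>.\<close>
  define T' where "T' f n z = (let t = (\<lambda>i. if i < n then snd (f i) else z) in
      (\<lambda>(i, j, m). (fst (f i) * t j) * star (t m)) ` ({..<n} \<times> {..n} \<times> {..n}))"
    for f :: "nat \<Rightarrow> 's \<times> 's" and n z
  have fin: "finite (T f n)" "finite (T' f n z)" for f n z
    by (simp_all add: T_def T'_def Let_def)
  define P where "P f n r \<longleftrightarrow> (\<forall>x\<in>T f n. \<not> snd r \<approx> x) \<and> (\<forall>x\<in>T' f n (snd r). \<not> fst r \<approx> x)"
    for f n and r :: "'s \<times> 's"
  have "\<exists>f. \<forall>n. P f n (f n)"
  \<comment> \<open>Recursive choice applies because \<open>P f n\<close> looks at \<open>f\<close>
    only below n.\<close>
  proof (rule dependent_wf_choice[OF wf_less])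
    fix n r and f g :: "nat \<Rightarrow> 's \<times> 's"
    assume fg: "\<And>i. (i, n) \<in> {(x, y). x < y} \<Longrightarrow> f i = g i"
    have "T f n = T g n"
      unfolding T_def by (rule image_cong) (auto simp: fg)
    moreover have "T' f n z = T' g n z" for z
      unfolding T'_def Let_def by (rule image_cong) (auto simp: fg)
    ultimately show "P f n r = P g n r" by (simp add: P_def)
  next
    fix n and f :: "nat \<Rightarrow> 's \<times> 's"
    obtain z where z: "\<forall>x\<in>T f n. \<not> z \<approx> x" using exists_group_cong_avoiding[OF inf fin(1)] by blast
    obtain y where "\<forall>x\<in>T' f n z. \<not> y \<approx> x" using exists_group_cong_avoiding[OF inf fin(2)] by blast
    with z show "\<exists>r. P f n r" by (intro exI[of _ "(y, z)"]) (simp add: P_def)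
  qed
  then obtain f where f: "\<And>n. P f n (f n)" by blast
  define s t where "s n = fst (f n)" and "t n = snd (f n)" for n
  have t: "\<not> t n \<approx> star (s i) * (s j * t m)" if "i < n" "j < n" "m < n" for n i j m
    using f[of n] that by (auto simp: P_def T_def s_def t_def)
  have s: "\<not> s n \<approx> (s i * t j) * star (t m)" if "i < n" "j \<le> n" "m \<le> n" for n i j m
  proof -
    have "(if l < n then snd (f l) else snd (f n)) = t l" if "l \<le> n" for l
      using that by (auto simp: t_def)
    then have "(s i * t j) * star (t m) \<in> T' f n (snd (f n))"
      unfolding T'_def Let_def using that by (intro image_eqI[of _ _ "(i, j, m)"]) (simp_all add: s_def)
    then show ?thesis
      using f[of n] by (auto simp: P_def s_def)
  qed
  show thesis
  proof (rule that)
    fix n m p q :: nat assume nm: "n < m" and qp: "q \<le> p"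
    show "\<not> s n * t m \<approx> s p * t q"
    proof
      assume c: "s n * t m \<approx> s p * t q"
      show False
      \<comment> \<open>If p < m, then n, p and q are all below m, and t_m would be a solution
        excluded by \<open>T\<close>. Otherwise n < m \<le> p and q \<le> p, and s_p would be one
        excluded by \<open>T'\<close>.\<close>
      proof (cases "p < m")
        case True
        with c nm qp t[of n m p q] show False
          by (auto dest: group_cong_cancel_left)
      next
        case False
        with group_cong_cancel_right[OF group_cong_sym[OF c]] nm qp s[of n p m q] show False
          by simp
      qed
    qed
  qed
qed


section \<open>Module Arens regularity of the triangular algebra\<close>

lemma closed_ideal_generated_superset: "X \<subseteq> closed_ideal_generated X"
  by (auto simp: closed_ideal_generated_def)

lemma closed_ideal_closed_ideal_generated: "closed_ideal (closed_ideal_generated X)"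
proof -
  have "closed (closed_ideal_generated X)"
    unfolding closed_ideal_generated_def by (intro closed_Inter) (auto simp: closed_ideal_def)
  moreover have "csubspace (closed_ideal_generated X)"
    by (auto simp: closed_ideal_generated_def closed_ideal_def complex_vector.subspace_def)
  ultimately show ?thesis
    by (auto simp: closed_ideal_def closed_ideal_generated_def)
qed

lemma closed_ideal_module_ideal: "closed_ideal (module_ideal \<AA> lact ract)"
  unfolding module_ideal_def by (rule closed_ideal_closed_ideal_generated)

text \<open>The entries (1,1), (1,2), (2,2) are numbered 0, 1, 2 so that they can index sums; every
  number from 2 on means (2,2).\<close>

definition tri_unit :: "nat \<Rightarrow> 'a::zero \<Rightarrow> 'a tri"
  where "tri_unit i x = (if i = 0 then Tri x 0 0 else if i = 1 then Tri 0 x 0 else Tri 0 0 x)"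

definition tri_entry :: "nat \<Rightarrow> 'a tri \<Rightarrow> 'a"
  where "tri_entry i = (if i = 0 then tri11 else if i = 1 then tri12 else tri22)"

lemma tri_sum_units: "A = (\<Sum>i<3. tri_unit i (tri_entry i A))" for A :: "'a::complex_normed_vector tri"
  by (cases A) (simp add: numeral_3_eq_3 tri_unit_def tri_entry_def plus_tri_def zero_tri_def)

lemma bounded_linear_tri_unit: "bounded_linear (tri_unit i :: 'a::complex_normed_vector \<Rightarrow> _)"
  by (rule bounded_linear_intro[where K = 1])
    (simp_all add: tri_unit_def plus_tri_def scaleR_tri_def scaleC_tri_def scaleR_scaleC norm_tri_def
      complex_vector.scale_zero_right)

lemma tri_unit_scaleC: "tri_unit i (c *\<^sub>C x) = c *\<^sub>C tri_unit i x" for x :: "'a::complex_normed_vector"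
  by (simp add: tri_unit_def scaleC_tri_def complex_vector.scale_zero_right)

lemma bounded_linear_tri_entry: "bounded_linear (tri_entry i :: 'a::complex_normed_vector tri \<Rightarrow> _)"
  by (simp add: tri_entry_def bounded_linear_tri_entries)

lemma tri_entry_scaleC: "tri_entry i (c *\<^sub>C A) = c *\<^sub>C tri_entry i A"
  by (simp add: tri_entry_def scaleC_tri_def)

lemma bilinear_ext_zero: "bilinear_ext \<phi> 0 g = 0" "bilinear_ext \<phi> f 0 = 0"
  using bilinear_ext_scaleC(1)[of \<phi> 0 0 g] bilinear_ext_scaleC(2)[of \<phi> f 0 0]
  by (simp_all add: complex_vector.scale_zero_left)

lemma point_mass_in_ell1_on: "\<delta> s \<in> ell1_on A \<longleftrightarrow> s \<in> A"
  by (auto simp: ell1_on_def point_mass.rep_eq)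

text \<open>Each generator of the span defining \<approx>, placed in entry i, is itself a generator
  of the module ideal: the right action inserts e between the two factors, while the left action
  drops it.\<close>

lemma tri_unit_group_cong:
  fixes s t :: "'s::inverse_semigroup"
  assumes "s \<approx> t"
  shows "tri_unit i (\<delta> s) - tri_unit i (\<delta> t) \<in> module_ideal T0_scalars T0_lact T0_ract" (is "_ \<in> ?J")
proof -
  let ?X = "{\<delta> (u * e * v) - \<delta> (u * v) | u e v :: 's. e \<in> idempotents}"
  interpret bounded_linear "tri_unit i :: 's ell1 \<Rightarrow> _" by (rule bounded_linear_tri_unit)
  have J: "closed ?J" "csubspace ?J"
    using closed_ideal_module_ideal by (auto simp: closed_ideal_def)
  have "tri_unit i (\<delta> s - \<delta> t) \<in> ?J"
  proof (rule closure_cspan_minimal[OF bounded_linear_tri_unit tri_unit_scaleC J])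
    show "\<delta> s - \<delta> t \<in> closure (cspan ?X)"
      using assms by (simp add: group_cong_def)
    fix x assume "x \<in> ?X"
    then obtain u e v where x: "x = \<delta> (u * e * v) - \<delta> (u * v)" and e: "e \<in> idempotents" by blast
    define \<alpha> where "\<alpha> = Tri (\<delta> e) 0 (\<delta> e)"
    \<comment> \<open>The left factor sits on the diagonal in the row of entry i, so its product
      with \<open>b\<close> stays in entry i.\<close>
    define a b where "a = (if i = 0 \<or> i = 1 then Tri (\<delta> u) 0 0 else Tri 0 0 (\<delta> u))" and "b = tri_unit i (\<delta> v)"
    have "\<alpha> \<in> T0_scalars"
      using e by (simp add: \<alpha>_def T0_scalars_iff point_mass_in_ell1_on)
    then have "T0_ract a \<alpha> * b - a * T0_lact \<alpha> b \<in> ?J"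
      unfolding module_ideal_def by (intro subsetD[OF closed_ideal_generated_superset]) blast
    also have "T0_ract a \<alpha> * b - a * T0_lact \<alpha> b = tri_unit i x"
      by (simp add: x a_def b_def \<alpha>_def tri_unit_def T0_ract_def T0_lact_def times_tri_def minus_tri_def
          ell1_ract_point_mass ell1_lact_point_mass point_mass_mult)
        (simp add: ell1_ract_def ell1_lact_def bilinear_ext_zero)
    finally show "tri_unit i x \<in> ?J" .
  qed
  then show ?thesis by (simp add: diff)
qed

text \<open>Since \<open>f\<close> vanishes on an ideal, a point mass in an entry of the left factor
  may be replaced by that of a class representative. So \<open>f\<close> sees each entry of
  \<open>a\<close> only through its total masses on the finitely many classes.\<close>

lemma finite_rank_if_finite_group_image:
  fixes f :: "'s::inverse_semigroup ell1 tri cdual"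
  assumes fin: "finite (max_group_image :: 's set set)"
    and f: "f \<in> annihilator (module_ideal T0_scalars T0_lact T0_ract)"
  shows "\<exists>\<phi> \<psi>. \<forall>a b. \<langle>f, a * b\<rangle> =
    (\<Sum>c\<in>(max_group_image :: 's set set) \<times> {..<3::nat}. \<langle>\<phi> c, a\<rangle> * \<langle>\<psi> c, b\<rangle>)"
proof -
  let ?G = "max_group_image :: 's set set" and ?J = "module_ideal T0_scalars T0_lact T0_ract"
  define r :: "'s set \<Rightarrow> 's" where "r C = (SOME s. s \<in> C)" for C
  \<comment> \<open>\<open>\<xi> C\<close> will be the total mass on \<open>C\<close>.\<close>
  have "\<forall>C :: 's set. \<exists>g. \<forall>x. \<langle>g, x\<rangle> = (\<Sum>\<^sub>\<infinity>u. ell1_coeff x u * (if u \<in> C then 1 else 0))"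
  proof
    show "\<exists>g. \<forall>x. \<langle>g, x\<rangle> = (\<Sum>\<^sub>\<infinity>u. ell1_coeff x u * (if u \<in> C then 1 else 0))" for C :: "'s set"
      by (rule bounded_function_cdual[where K = 1 and k = "\<lambda>u. if u \<in> C then 1 else 0"]) simp
  qed
  from choice[OF this] obtain \<xi>
    where \<xi>: "\<And>C x. \<langle>\<xi> C, x\<rangle> = (\<Sum>\<^sub>\<infinity>u. ell1_coeff x u * (if u \<in> (C :: 's set) then 1 else 0))"
    by blast
  have eq: "\<langle>f, tri_unit i x * b\<rangle> = (\<Sum>C\<in>?G. \<langle>\<xi> C, x\<rangle> * \<langle>f, tri_unit i (\<delta> (r C)) * b\<rangle>)" for i x b
  proof -
    have "\<exists>h. \<forall>x. \<langle>h, x\<rangle> = \<langle>f, tri_unit i x * b\<rangle>"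
      by (rule cdual_compose)
        (simp_all add: tri_unit_scaleC mult_scaleC_left
          bounded_linear_compose[OF bounded_linear_mult_left bounded_linear_tri_unit])
    then obtain h where h: "\<And>x. \<langle>h, x\<rangle> = \<langle>f, tri_unit i x * b\<rangle>" by blast
    \<comment> \<open>On a point mass at s only the class of s contributes to the sum.\<close>
    have "h = (\<Sum>C\<in>?G. \<langle>f, tri_unit i (\<delta> (r C)) * b\<rangle> *\<^sub>C \<xi> C)"
    proof (rule cdual_ell1_eqI)
      fix s :: 's
      let ?C = "{(s, t). s \<approx> t} `` {s}"
      have C: "?C \<in> ?G" unfolding max_group_image_def by (rule quotientI) simp
      have iff: "s \<in> D \<longleftrightarrow> D = ?C" if D: "D \<in> ?G" for D
      proof
        obtain t where t: "D = {(s, t). s \<approx> t} `` {t}"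
          using D unfolding max_group_image_def by (rule quotientE)
        assume "s \<in> D"
        then show "D = ?C"
          unfolding t by (intro equiv_class_eq[OF equiv_group_cong]) simp
      qed (simp add: group_cong_refl)
      have "r ?C \<in> ?C"
        unfolding r_def by (rule someI[of _ s]) (simp add: group_cong_refl)
      then have "s \<approx> r ?C" by simp
      then have "tri_unit i (\<delta> s) - tri_unit i (\<delta> (r ?C)) \<in> ?J" by (rule tri_unit_group_cong)
      then have "(tri_unit i (\<delta> s) - tri_unit i (\<delta> (r ?C))) * b \<in> ?J"
        using closed_ideal_module_ideal[of T0_scalars T0_lact T0_ract]
        unfolding closed_ideal_def by blast
      then have "\<langle>f, (tri_unit i (\<delta> s) - tri_unit i (\<delta> (r ?C))) * b\<rangle> = 0"
        using f by (simp add: annihilator_def)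
      then have "\<langle>h, \<delta> s\<rangle> = \<langle>f, tri_unit i (\<delta> (r ?C)) * b\<rangle>"
        by (simp add: h left_diff_distrib dual_apply_diff)
      also have "\<dots> = (\<Sum>D\<in>?G. if D = ?C then \<langle>f, tri_unit i (\<delta> (r D)) * b\<rangle> else 0)"
        using fin C by simp
      also have "\<dots> = (\<Sum>D\<in>?G. \<langle>f, tri_unit i (\<delta> (r D)) * b\<rangle> * \<langle>\<xi> D, \<delta> s\<rangle>)"
        by (rule sum.cong) (auto simp: \<xi> infsum_point_mass iff simp del: Image_singleton_iff)
      finally show "\<langle>h, \<delta> s\<rangle> = \<langle>\<Sum>C\<in>?G. \<langle>f, tri_unit i (\<delta> (r C)) * b\<rangle> *\<^sub>C \<xi> C, \<delta> s\<rangle>"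
        by (simp add: sum_cdual_apply scaleC_cdual.rep_eq)
    qed
    then have "\<langle>h, x\<rangle> = \<langle>\<Sum>C\<in>?G. \<langle>f, tri_unit i (\<delta> (r C)) * b\<rangle> *\<^sub>C \<xi> C, x\<rangle>"
      by (rule arg_cong)
    then show ?thesis
      by (simp add: h sum_cdual_apply scaleC_cdual.rep_eq mult.commute)
  qed
  have "\<forall>c. \<exists>g. \<forall>A. \<langle>g, A\<rangle> = \<langle>\<xi> (fst c), tri_entry (snd c) A\<rangle>"
    by (intro allI cdual_compose[OF bounded_linear_tri_entry tri_entry_scaleC])
  from choice[OF this] obtain \<phi> where \<phi>: "\<And>c A. \<langle>\<phi> c, A\<rangle> = \<langle>\<xi> (fst c), tri_entry (snd c) A\<rangle>"
    by blast
  have "\<langle>f, a * b\<rangle> = (\<Sum>c\<in>?G \<times> {..<3}. \<langle>\<phi> c, a\<rangle> *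
      \<langle>(\<lambda>(C, i). dual_right f (tri_unit i (\<delta> (r C)))) c, b\<rangle>)" for a b
  proof -
    have "\<langle>f, a * b\<rangle> = \<langle>f, (\<Sum>i<3. tri_unit i (tri_entry i a)) * b\<rangle>"
      by (subst tri_sum_units[of a]) (rule refl)
    also have "\<dots> = (\<Sum>i<3. \<Sum>C\<in>?G. \<langle>\<phi> (C, i), a\<rangle> * \<langle>dual_right f (tri_unit i (\<delta> (r C))), b\<rangle>)"
      unfolding \<phi> dual_right.rep_eq fst_conv snd_conv eq[symmetric]
      by (simp only: sum_distrib_right dual_apply_sum)
    also have "\<dots> = (\<Sum>C\<in>?G. \<Sum>i<3. \<langle>\<phi> (C, i), a\<rangle> * \<langle>dual_right f (tri_unit i (\<delta> (r C))), b\<rangle>)"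
      by (rule sum.swap)
    finally show ?thesis
      by (simp only: sum.cartesian_product case_prod_unfold prod.collapse)
  qed
  then show ?thesis by blast
qed

section \<open>Bounding the module ideal from outside by balanced functions\<close>

lemma ell1_mult_test:
  assumes "\<And>u. cmod (k u) \<le> K"
  shows "(\<Sum>\<^sub>\<infinity>u. ell1_coeff (x * y) u * k u) =
    (\<Sum>\<^sub>\<infinity>s. ell1_coeff x s * (\<Sum>\<^sub>\<infinity>t. ell1_coeff y t * k (s * t)))"
  unfolding times_ell1_def using assms by (rule bilinear_ext_test)

text \<open>These are the bounded functions whose functionals on ell^1 vanish on the generators of
  the span defining \<approx>.\<close>

definition balanced :: "('s::inverse_semigroup \<Rightarrow> complex) \<Rightarrow> bool"
  where "balanced k \<longleftrightarrow> (\<exists>K. \<forall>u. cmod (k u) \<le> K) \<and> (\<forall>s e t. e \<in> idempotents \<longrightarrow> k (s * e * t) = k (s * t))"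

lemma balanced_functional:
  assumes "balanced k"
  obtains f where "\<And>x. \<langle>f, x\<rangle> = (\<Sum>\<^sub>\<infinity>u. ell1_coeff x u * k u)"
  using assms bounded_function_cdual[of k] unfolding balanced_def by metis

text \<open>As a common kernel of functionals, this set admits a direct membership test, unlike the
  ideal generated abstractly.\<close>

definition balanced_kernel :: "'s::inverse_semigroup ell1 set"
  where "balanced_kernel = {x. \<forall>k. balanced k \<longrightarrow> (\<Sum>\<^sub>\<infinity>u. ell1_coeff x u * k u) = 0}"

text \<open>An intersection of kernels is a closed subspace. It absorbs products because translates
  of a balanced function, and their sums weighted by an ell^1 element, are again balanced.\<close>

lemma closed_ideal_balanced_kernel: "closed_ideal (balanced_kernel :: 's::inverse_semigroup ell1 set)"
proof -
  let ?N = "balanced_kernel :: 's ell1 set"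
  define D where "D = {f :: 's ell1 cdual. \<exists>k. balanced k \<and> (\<forall>x. \<langle>f, x\<rangle> = (\<Sum>\<^sub>\<infinity>u. ell1_coeff x u * k u))}"
  have N: "?N = (\<Inter>f\<in>D. {x. \<langle>f, x\<rangle> = 0})"
  proof (intro set_eqI iffI INT_I CollectI)
    show "\<langle>f, x\<rangle> = 0" if "x \<in> ?N" "f \<in> D" for x f
      using that by (auto simp: balanced_kernel_def D_def)
    show "x \<in> ?N" if x: "x \<in> (\<Inter>f\<in>D. {x. \<langle>f, x\<rangle> = 0})" for x
      unfolding balanced_kernel_def
    proof (intro CollectI allI impI)
      fix k :: "'s \<Rightarrow> complex" assume k: "balanced k"
      obtain f where f: "\<And>x. \<langle>f, x\<rangle> = (\<Sum>\<^sub>\<infinity>u. ell1_coeff x u * k u)"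
        using balanced_functional[OF k] by blast
      with k have "f \<in> D" by (auto simp: D_def)
      with x f show "(\<Sum>\<^sub>\<infinity>u. ell1_coeff x u * k u) = 0" by auto
    qed
  qed
  have "closed ?N"
    unfolding N by (intro closed_INT ballI closed_Collect_eq continuous_on_const
        bounded_linear.continuous_on[OF bounded_linear_dual_apply continuous_on_id])
  moreover have "csubspace ?N"
    unfolding N by (auto simp: complex_vector.subspace_def dual_apply_add dual_apply_zero dual_apply_scaleC)
  moreover have "y * x \<in> ?N \<and> x * y \<in> ?N" if x: "x \<in> ?N" for x y
  proof -
    have "(\<Sum>\<^sub>\<infinity>u. ell1_coeff (y * x) u * k u) = 0 \<and> (\<Sum>\<^sub>\<infinity>u. ell1_coeff (x * y) u * k u) = 0"
      if k: "balanced k" for k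
    proof
      obtain K where K: "\<And>u. cmod (k u) \<le> K" using k by (auto simp: balanced_def)
      have "balanced (\<lambda>t. k (s * t))" for s
        using k unfolding balanced_def by (metis mult.assoc)
      then show "(\<Sum>\<^sub>\<infinity>u. ell1_coeff (y * x) u * k u) = 0"
        using x by (simp add: ell1_mult_test[OF K] balanced_kernel_def)
      have "k (s * e * t * u) = k (s * t * u)" if "e \<in> idempotents" for s e t u
        using k that unfolding balanced_def by (simp add: mult.assoc)
      \<comment> \<open>Here \<open>y\<close> is absorbed into the test function, so that only
        \<open>x\<close> remains to be tested.\<close>
      then have "balanced (\<lambda>s. \<Sum>\<^sub>\<infinity>t. ell1_coeff y t * k (s * t))"
        using ell1_pairing(2)[of "\<lambda>t. k (_ * t)" K y] K unfolding balanced_def by auto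
      then show "(\<Sum>\<^sub>\<infinity>u. ell1_coeff (x * y) u * k u) = 0"
        using x by (simp add: ell1_mult_test[OF K] balanced_kernel_def)
    qed
    then show ?thesis by (simp add: balanced_kernel_def)
  qed
  ultimately show ?thesis by (auto simp: closed_ideal_def)
qed

text \<open>Tested against \<open>k\<close>, the two terms become triple sums that differ only in
  \<open>k (s * e * t)\<close> versus \<open>k (s * t)\<close>.\<close>

lemma ell1_action_diff_in_balanced_kernel:
  assumes \<alpha>: "\<alpha> \<in> ell1_on idempotents"
  shows "ell1_ract x \<alpha> * y - x * ell1_lact \<alpha> y \<in> balanced_kernel"
proof -
  have "(\<Sum>\<^sub>\<infinity>u. ell1_coeff (ell1_ract x \<alpha> * y - x * ell1_lact \<alpha> y) u * k u) = 0" if k: "balanced k" for k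
  proof -
    obtain K where K: "\<And>u. cmod (k u) \<le> K" using k by (auto simp: balanced_def)
    obtain f where f: "\<And>x. \<langle>f, x\<rangle> = (\<Sum>\<^sub>\<infinity>u. ell1_coeff x u * k u)"
      using balanced_functional[OF k] by blast
    have bd: "cmod (\<Sum>\<^sub>\<infinity>t. ell1_coeff y t * k (s * t)) \<le> norm y * K" for s
      by (rule ell1_pairing(2)) (rule K)
    have "\<langle>f, ell1_ract x \<alpha> * y\<rangle> =
        (\<Sum>\<^sub>\<infinity>s. ell1_coeff x s * (\<Sum>\<^sub>\<infinity>e. ell1_coeff \<alpha> e * (\<Sum>\<^sub>\<infinity>t. ell1_coeff y t * k (s * e * t))))"
      unfolding f ell1_mult_test[OF K] ell1_ract_def by (rule bilinear_ext_test) (rule bd)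
    also have "\<dots> = (\<Sum>\<^sub>\<infinity>s. ell1_coeff x s * (\<Sum>\<^sub>\<infinity>e. ell1_coeff \<alpha> e * (\<Sum>\<^sub>\<infinity>t. ell1_coeff y t * k (s * t))))"
    proof -
      \<comment> \<open>For e outside the idempotents the coefficient of \<alpha> is 0; for the
        others \<open>k\<close> is balanced.\<close>
      have "ell1_coeff \<alpha> e * (\<Sum>\<^sub>\<infinity>t. ell1_coeff y t * k (s * e * t)) =
          ell1_coeff \<alpha> e * (\<Sum>\<^sub>\<infinity>t. ell1_coeff y t * k (s * t))" for s e
        using k \<alpha> by (cases "e \<in> idempotents") (simp_all add: balanced_def ell1_on_def)
      then show ?thesis by presburger
    qed
    also have "\<dots> = \<langle>f, x * ell1_lact \<alpha> y\<rangle>"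
      unfolding f ell1_mult_test[OF K] ell1_lact_def by (simp add: bilinear_ext_test[where K = K] K)
    finally show ?thesis by (simp add: f[symmetric] dual_apply_diff)
  qed
  then show ?thesis by (simp add: balanced_kernel_def)
qed

text \<open>Taking the (1,1) entry is multiplicative on triangular matrices, so the preimage of a
  closed ideal is a closed ideal. This one contains the generators of the module ideal.\<close>

lemma module_ideal_tri11:
  assumes "A \<in> module_ideal T0_scalars T0_lact T0_ract"
  shows "tri11 A \<in> balanced_kernel"
proof -
  let ?I = "tri11 -` balanced_kernel :: 'a ell1 tri set"
  note N = closed_ideal_balanced_kernel[where 's = 'a, unfolded closed_ideal_def]
  have "closed ?I"
    using N by (intro continuous_closed_vimage) (auto intro: bounded_linear.continuous[OF bounded_linear_tri_entries(1)])
  moreover have "csubspace ?I"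
    using N by (auto simp: complex_vector.subspace_def plus_tri_def scaleC_tri_def zero_tri_def)
  ultimately have "closed_ideal ?I"
    using N by (auto simp: closed_ideal_def times_tri_def)
  moreover have "{T0_ract a \<alpha> * b - a * T0_lact \<alpha> b | a \<alpha> b. \<alpha> \<in> T0_scalars} \<subseteq> ?I"
    by (auto simp: T0_scalars_iff T0_ract_def T0_lact_def times_tri_def minus_tri_def
        intro!: ell1_action_diff_in_balanced_kernel)
  ultimately show ?thesis
    using assms unfolding module_ideal_def closed_ideal_generated_def by blast
qed

theorem mainTheorem8:
  shows "module_arens_regular (T0_scalars :: 's::inverse_semigroup ell1 tri set) T0_lact T0_ract
    \<longleftrightarrow> finite (max_group_image :: 's set set)"
proof
  assume "finite (max_group_image :: 's set set)"
  then show "module_arens_regular (T0_scalars :: 's ell1 tri set) T0_lact T0_ract"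
    unfolding module_arens_regular_iff
    using finite_rank_if_finite_group_image arens_eq_if_finite_rank by blast
next
  assume reg: "module_arens_regular (T0_scalars :: 's ell1 tri set) T0_lact T0_ract"
  show "finite (max_group_image :: 's set set)"
  proof (rule ccontr)
    assume "infinite (max_group_image :: 's set set)"
    then obtain s t :: "nat \<Rightarrow> 's" where st: "\<And>n m p q. n < m \<Longrightarrow> q \<le> p \<Longrightarrow> \<not> s n * t m \<approx> s p * t q"
      using separated_product_sequences by blast
    define k :: "'s \<Rightarrow> complex" where "k u = (if \<exists>n m. n < m \<and> s n * t m \<approx> u then 1 else 0)" for u
    \<comment> \<open>A function constant on classes ignores an idempotent inserted between two
      factors, hence is balanced.\<close>
    have "k u = k v" if "u \<approx> v" for u v
      using that group_cong_trans group_cong_sym unfolding k_def by meson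
    then have k: "balanced k"
      unfolding balanced_def by (auto intro!: exI[of _ 1] group_cong_idempotent) (simp add: k_def)
    obtain g where g: "\<And>x. \<langle>g, x\<rangle> = (\<Sum>\<^sub>\<infinity>u. ell1_coeff x u * k u)"
      using balanced_functional[OF k] by blast
    have "\<exists>f. \<forall>A. \<langle>f, A\<rangle> = \<langle>g, tri11 A\<rangle>"
      by (rule cdual_compose[OF bounded_linear_tri_entries(1)]) (simp add: scaleC_tri_def)
    then obtain f where f: "\<And>A. \<langle>f, A\<rangle> = \<langle>g, tri11 A\<rangle>" by blast
    have "f \<in> annihilator (module_ideal T0_scalars T0_lact T0_ract)"
      using module_ideal_tri11 k by (auto simp: annihilator_def f g balanced_kernel_def)
    then have eq: "\<langle>\<Gamma>\<^sub>1 \<box> \<Gamma>\<^sub>2, f\<rangle> = \<langle>\<Gamma>\<^sub>1 \<diamond> \<Gamma>\<^sub>2, f\<rangle>" for \<Gamma>\<^sub>1 \<Gamma>\<^sub>2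
      using reg unfolding module_arens_regular_iff by blast
    have norm: "norm (Tri (\<delta> x) 0 0 :: 's ell1 tri) \<le> 1" for x
      by (simp add: norm_tri_def norm_point_mass)
    have val: "\<langle>f, Tri (\<delta> x) 0 0 * Tri (\<delta> y) 0 0\<rangle> = k (x * y)" for x y
      by (simp add: f g times_tri_def point_mass_mult infsum_point_mass)
    have "\<exists>\<Gamma>\<^sub>1 \<Gamma>\<^sub>2. \<langle>\<Gamma>\<^sub>1 \<box> \<Gamma>\<^sub>2, f\<rangle> \<noteq> \<langle>\<Gamma>\<^sub>1 \<diamond> \<Gamma>\<^sub>2, f\<rangle>"
    proof (rule arens_products_differ)
      show "norm (Tri (\<delta> (s n)) 0 0 :: 's ell1 tri) \<le> 1" "norm (Tri (\<delta> (t n)) 0 0 :: 's ell1 tri) \<le> 1" for n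
        by (rule norm)+
      show "\<langle>f, Tri (\<delta> (s n)) 0 0 * Tri (\<delta> (t m)) 0 0\<rangle> = 1" if "n < m" for n m
        unfolding val k_def using that group_cong_refl by auto
      \<comment> \<open>A value 1 would make a product with increasing indices congruent to
        \<open>s n * t m\<close> with m \<le> n, against \<open>st\<close>.\<close>
      show "\<langle>f, Tri (\<delta> (s n)) 0 0 * Tri (\<delta> (t m)) 0 0\<rangle> = 0" if "m \<le> n" for n m
        unfolding val k_def using that st by auto
    qed
    with eq show False by blast
  qed
qed

end
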